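(* Let $\{q_n\}$ be the Fibonacci Quilt sequence and consider $m\in I_n:=[q_n,q_{n+1})$. Let $P_n(g)$ be the fraction of all gaps $\ell_i-\ell_{i+1}$ in the Greedy-6 decompositions $m=q_{\ell_1}+\dots+q_{\ell_t}$ ($\ell_1>\dots>\ell_t$) of all $m\in I_n$ that equal $g$. Then $P(g):=\lim_{n\to\infty}P_n(g)$ exists and agrees with the corresponding limit for the $(4,1)$-Generacci sequence, namely the limit as $n\to\infty$ of the fraction of gaps equal to $g$ among the $(4,1)$-Generacci legal decompositions of all integers in $[a_n,a_{n+1})$. Moreover, for $z$ chosen uniformly from $I_n$, the spacing gap measures $\nu_{z,n}(x)=\frac1{t(z)-1}\sum_{i=1}^{t(z)-1}\delta(x-(\ell_i-\ell_{i+1}))$ of the Greedy-6 decomposition converge almost surely in distribution to the limiting gap measure $\sum_g P(g)\delta(x-g)$ of the $(4,1)$-Generacci sequence.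
   Context: Given an increasing sequence $\{q_i\}$, a decomposition $m=q_{\ell_1}+\dots+q_{\ell_t}$ with $q_{\ell_1}>\dots>q_{\ell_t}$ is FQ-legal if $|\ell_i-\ell_j|\notin\{0,1,3,4\}$ for $i\neq j$ and $\{1,3\}\not\subset\{\ell_1,\dots,\ell_t\}$. The Fibonacci Quilt sequence has $q_1=1$ and each $q_i$ ($i\ge 2$) is the smallest positive integer with no FQ-legal decomposition using $q_1,\dots,q_{i-1}$ (it begins $1,2,3,4,5,7,9,12,\dots$). The Greedy-6 decomposition of $m$: if $m=q_n$ it is $q_n$; if $m=6$ it is $q_4+q_2$; otherwise write $m=q_{\ell_1}+x$ with $q_{\ell_1}<m<q_{\ell_1+1}$, $x>0$, and iterate on $x$. The $(4,1)$-Generacci sequence $\{a_n\}$ is the increasing sequence in which each $a_i$ is the smallest positive integer not expressible as a sum of distinct earlier terms $a_{\ell_1}+\dots+a_{\ell_k}$ with $\ell_i-\ell_{i+1}\ge5$; such decompositions (legal decompositions) exist and are unique for every positive integer. $t(z)$ denotes the number of summands of $z$; $\delta(x-a)$ is the Dirac mass at $a$. *)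

theory Defs
  imports "HOL-Probability.Probability"
begin

definition idist :: "nat \<Rightarrow> nat \<Rightarrow> nat" where
  "idist i j = (if i \<le> j then j - i else i - j)"

definition FQ_legal :: "nat set \<Rightarrow> bool" where
  "FQ_legal S \<longleftrightarrow> finite S \<and>
     (\<forall>i\<in>S. \<forall>j\<in>S. i \<noteq> j \<longrightarrow> idist i j \<notin> {0, 1, 3, 4}) \<and>
     \<not> ({1, 3} \<subseteq> S)"

fun qlist :: "nat \<Rightarrow> nat list" where
  "qlist 0 = []"
| "qlist (Suc k) = qlist k @
     [LEAST m. 0 < m \<and> \<not> (\<exists>S. S \<subseteq> {1..k} \<and> FQ_legal S \<and>
                             (\<Sum>i\<in>S. qlist k ! (i - 1)) = m)]"

definition fq :: "nat \<Rightarrow> nat" where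
  "fq i = (if i = 0 then 0 else qlist i ! (i - 1))"

text \<open>Greedy-6 decomposition: list of indices l_1 > l_2 > ... > l_t.
  The first argument is fuel; each step subtracts a positive term, so fuel m suffices.\<close>
fun greedy_aux :: "nat \<Rightarrow> nat \<Rightarrow> nat list" where
  "greedy_aux 0 m = []"
| "greedy_aux (Suc k) m =
     (if m = 0 then []
      else if (\<exists>n\<ge>1. fq n = m) then [THE n. n \<ge> 1 \<and> fq n = m]
      else if m = 6 then [4, 2]
      else (let l = (THE l. l \<ge> 1 \<and> fq l < m \<and> m < fq (Suc l))
            in l # greedy_aux k (m - fq l)))"

definition greedy6 :: "nat \<Rightarrow> nat list" where
  "greedy6 m = greedy_aux m m"

definition gen_legal :: "nat set \<Rightarrow> bool" where
  "gen_legal S \<longleftrightarrow> finite S \<and> (\<forall>i\<in>S. \<forall>j\<in>S. i \<noteq> j \<longrightarrow> idist i j \<ge> 5)"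

fun glist :: "nat \<Rightarrow> nat list" where
  "glist 0 = []"
| "glist (Suc k) = glist k @
     [LEAST m. 0 < m \<and> \<not> (\<exists>S. S \<subseteq> {1..k} \<and> gen_legal S \<and>
                             (\<Sum>i\<in>S. glist k ! (i - 1)) = m)]"

definition ga :: "nat \<Rightarrow> nat" where
  "ga i = (if i = 0 then 0 else glist i ! (i - 1))"

definition gen_decomp :: "nat \<Rightarrow> nat list" where
  "gen_decomp m = rev (sorted_list_of_set
     (THE S. S \<subseteq> {1..} \<and> gen_legal S \<and> (\<Sum>i\<in>S. ga i) = m))"

definition gaps :: "nat list \<Rightarrow> nat list" where
  "gaps xs = map (\<lambda>i. xs ! i - xs ! Suc i) [0..<length xs - 1]"

definition gap_frac :: "(nat \<Rightarrow> nat) \<Rightarrow> (nat \<Rightarrow> nat list) \<Rightarrow> nat \<Rightarrow> nat \<Rightarrow> real" where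
  "gap_frac s dec n g =
     real (\<Sum>m\<in>{s n..<s (Suc n)}. count_list (gaps (dec m)) g) /
     real (\<Sum>m\<in>{s n..<s (Suc n)}. length (gaps (dec m)))"

definition nat_point_measure :: "(nat \<Rightarrow> real) \<Rightarrow> real measure" where
  "nat_point_measure w = distr (density (count_space UNIV) (\<lambda>g. ennreal (w g))) borel real"

definition indiv_gap_measure :: "nat \<Rightarrow> real measure" where
  "indiv_gap_measure z = nat_point_measure
     (\<lambda>g. real (count_list (gaps (greedy6 z)) g) / (real (length (greedy6 z)) - 1))"

definition FQ_interval :: "nat \<Rightarrow> nat set" where
  "FQ_interval n = {fq n..<fq (Suc n)}"

end

theory Submission
  imports Defs
begin

text \<open>
  Both sequences satisfy $c_{n+1} = c_n + c_{n-4}$ for large $n$, and the decomposition of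
  $m \in [c_n, c_{n+1})$ is $n$ followed by that of $m - c_n \in [0, c_{n-4})$. Hence the gaps behave
  like a renewal process in which a gap $g \ge 5$ has probability $p^g$, where $p^5 = 1 - p$;
  this is the common limit law. Let $X_g$ and $T$ be the number of gaps equal to $g$ and the total number of gaps.
  Exponential moments of $\pm(X_g - p^g T)$ and of $-T$ satisfy a renewal inequality, so outside
  an exponentially small proportion of $[c_n, c_{n+1})$ one has $T \ge \alpha n$ and
  $|X_g - p^g T| \le \epsilon n$. This gives the limits of the averaged gap
  fractions, and by Borel-Cantelli the almost sure limits of the individual ones.

  That the Fibonacci Quilt sequence satisfies the recurrence rests on two facts: the sum of
  an FQ-legal set of indices up to $n$ is less than $q_n + q_{n+1}$, and
  $q_{n+1} = q_{n-1} + q_{n-2}$.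
\<close>

section \<open>Exponential tail bounds for gap counts\<close>

lemma exists_root_scaled:
  fixes a b :: real
  assumes "0 \<le> a" "a < 1" "a ^ 5 < b * (1 - a)"
  shows "\<exists>v. a < v \<and> v < 1 \<and> v ^ 5 = b * (1 - v)"
proof -
  \<comment> \<open>The function \<open>v ^ 5 - b * (1 - v)\<close> is negative at \<open>a\<close>
    by assumption and equals 1 at \<open>v = 1\<close>.\<close>
  have "\<exists>v\<ge>a. v \<le> 1 \<and> v ^ 5 - b * (1 - v) = 0"
    by (rule IVT') (use assms in \<open>auto intro!: continuous_intros\<close>)
  then obtain v where v: "a \<le> v" "v \<le> 1" "v ^ 5 = b * (1 - v)" by auto
  moreover have "v \<noteq> a" "v \<noteq> 1" using v assms by auto
  ultimately show ?thesis by (intro exI[of _ v]) auto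
qed

lemma sum_power_from_5_le:
  fixes v :: real
  assumes "0 < v" "v < 1"
  shows "(\<Sum>g\<in>{5..n}. v ^ g) \<le> v ^ 5 / (1 - v)"
proof (cases "5 \<le> n")
  case True
  have "(\<Sum>g\<in>{5..n}. v ^ g) = (v ^ 5 - v ^ Suc n) / (1 - v)"
    using sum_gp[of v 5 n] True assms by simp
  also have "\<dots> \<le> v ^ 5 / (1 - v)"
    using assms by (intro divide_right_mono) auto
  finally show ?thesis .
qed (use assms in auto)

text \<open>In an exponential moment this keeps the linear term exact, so centring can cancel it.
  For \<open>x = - y\<close> with \<open>y > 0\<close>, \<open>exp y\<close> is at least its
  quadratic Taylor polynomial, whose product with \<open>1 - y + y\<^sup>2\<close> is at least
  1.\<close>

lemma exp_le_quadratic: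
  fixes x :: real
  assumes "\<bar>x\<bar> \<le> 1"
  shows "exp x \<le> 1 + x + x\<^sup>2"
proof (cases "0 \<le> x")
  case True
  then show ?thesis using exp_bound assms by auto
next
  case False
  define y where "y = - x"
  have y: "0 \<le> y" "x = - y" using False by (auto simp: y_def)
  have "1 \<le> (1 + y + y\<^sup>2 / 2) * (1 - y + y\<^sup>2)"
  proof -
    have "(1 + y + y\<^sup>2 / 2) * (1 - y + y\<^sup>2) = 1 + y\<^sup>2 / 2 + y ^ 3 / 2 + y ^ 4 / 2"
      by (simp add: field_simps power2_eq_square power3_eq_cube power4_eq_xxxx)
    then show ?thesis using y by simp
  qed
  also have "\<dots> \<le> exp y * (1 - y + y\<^sup>2)"
  proof (intro mult_right_mono exp_lower_Taylor_quadratic y)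
    have "0 \<le> (1 - y) + y\<^sup>2" using assms y by (intro add_nonneg_nonneg) auto
    then show "0 \<le> 1 - y + y\<^sup>2" by simp
  qed
  finally show ?thesis using y by (simp add: exp_minus field_simps)
qed

text \<open>A geometric law started at 5: when \<open>p ^ 5 = 1 - p\<close>, its total mass
  \<open>p ^ 5 / (1 - p)\<close> is 1.\<close>

definition limit_gap_prob :: "real \<Rightarrow> nat \<Rightarrow> real" where
  "limit_gap_prob p g = (if 5 \<le> g then p ^ g else 0)"

lemma length_gaps: "length (gaps xs) = length xs - 1"
  by (simp add: gaps_def)

lemma gaps_Cons_Cons: "gaps (a # b # xs) = (a - b) # gaps (b # xs)"
proof -
  have "[0..<Suc (length xs)] = 0 # map Suc [0..<length xs]"
    by (simp only: map_Suc_upt upt_conv_Cons[OF zero_less_Suc])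
  then show ?thesis by (simp add: gaps_def)
qed

text \<open>
  The indices below \<open>N\<close> are unconstrained, which absorbs the exceptional decomposition
  $6 = q_4 + q_2$ of the Fibonacci Quilt sequence.
\<close>

locale gap_scheme =
  fixes p :: real and c :: "nat \<Rightarrow> nat" and dec :: "nat \<Rightarrow> nat list" and N :: nat
  assumes p_pos: "0 < p" and p_less_1: "p < 1" and p_root: "p ^ 5 = 1 - p"
    and c_0: "c 0 = 0" and c_less: "c n < c (Suc n)" and N_ge: "5 \<le> N"
    and c_rec: "N \<le> n \<Longrightarrow> c (Suc n) = c n + c (n - 4)"
    and dec_rec: "N \<le> n \<Longrightarrow> m \<in> {c n..<c (Suc n)} \<Longrightarrow> dec m = n # dec (m - c n)"
begin

abbreviation I :: "nat \<Rightarrow> nat set" where "I n \<equiv> {c n..<c (Suc n)}"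

abbreviation P :: "nat \<Rightarrow> real" where "P \<equiv> limit_gap_prob p"

abbreviation ngaps :: "nat \<Rightarrow> nat" where "ngaps m \<equiv> length (gaps (dec m))"

text \<open>Unlike the ratio of the two counts, this centred count is additive when a gap is
  prepended, so its exponential is multiplicative and fits a renewal inequality.\<close>

definition gap_dev :: "nat \<Rightarrow> nat \<Rightarrow> real" where
  "gap_dev g m = count_list (gaps (dec m)) g - P g * ngaps m"

section \<open>The partition of the naturals into the intervals \<open>I n\<close>\<close>

lemma c_mono: "m \<le> n \<Longrightarrow> c m \<le> c n"
  by (rule lift_Suc_mono_le) (use c_less less_imp_le in auto)

lemma c_pos: "0 < n \<Longrightarrow> 0 < c n"
  using c_less[of "n - 1"] by simp

lemma P_nonneg: "0 \<le> P g" and P_le_1: "P g \<le> 1"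
  using p_pos p_less_1 by (auto simp: limit_gap_prob_def power_le_one)

lemma sum_below_c: "(\<Sum>x<c j. F x) = (\<Sum>k<j. \<Sum>x\<in>I k. F x)"
proof (induction j)
  case (Suc j)
  have "(\<Sum>x<c (Suc j). F x) = (\<Sum>x<c j. F x) + (\<Sum>x\<in>I j. F x)"
    using sum.atLeastLessThan_concat[of 0 "c j" "c (Suc j)" F] c_less[of j]
    by (simp add: atLeast0LessThan)
  then show ?case using Suc by simp
qed (simp add: c_0)

lemma index_exists: "x < c j \<Longrightarrow> \<exists>k<j. x \<in> I k"
proof (induction j)
  case (Suc j)
  show ?case
  proof (cases "x < c j")
    case True
    then show ?thesis using Suc.IH less_SucI by blast
  qed (use Suc.prems in auto)
qed (simp add: c_0)

text \<open>The renewal structure: removing the leading index \<open>n\<close> maps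
  \<open>I n\<close> bijectively onto the numbers below \<open>c (n - 4)\<close>, that is, onto the
  union of the \<open>I k\<close> with \<open>k \<le> n - 5\<close>.\<close>

lemma sum_I:
  assumes "N \<le> n"
  shows "(\<Sum>m\<in>I n. F m) = (\<Sum>k\<le>n - 5. \<Sum>x\<in>I k. F (c n + x))"
proof -
  have "(\<Sum>m\<in>I n. F m) = (\<Sum>x<c (n - 4). F (c n + x))"
    using sum.shift_bounds_nat_ivl[of F 0 "c n" "c (n - 4)"] c_rec[OF assms]
    by (simp add: atLeast0LessThan add.commute)
  moreover have "{..n - 5} = {..<n - 4}"
    using assms N_ge by auto
  ultimately show ?thesis by (simp add: sum_below_c)
qed

text \<open>Here \<open>h g\<close> is the factor by which a gap \<open>g\<close> changes the
  weight, and \<open>E\<close> is the allowance for the irregular indices below \<open>N\<close>.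
  The interval sums satisfy a renewal inequality with kernel \<open>h\<close>, and the condition on
  \<open>h\<close> says that multiples of \<open>(\<rho> / p) ^ n\<close> are supersolutions of
  it.\<close>

lemma exponential_moment_bound:
  fixes W h :: "nat \<Rightarrow> real"
  assumes W: "\<And>m. 0 \<le> W m" and h: "\<And>g. 0 \<le> h g" and "0 < \<rho>" "1 \<le> E"
    and step: "\<And>n k x. \<lbrakk>N \<le> n; k \<le> n - 5; x \<in> I k\<rbrakk> \<Longrightarrow>
                 W (c n + x) \<le> h (n - k) * (W x * (if k < N then E else 1))"
    and sum_h: "\<And>n. (\<Sum>g\<in>{5..n}. h g * (p / \<rho>) ^ g) \<le> 1"
  obtains C :: real where "0 \<le> C" "\<And>n. (\<Sum>m\<in>I n. W m) \<le> C * (\<rho> / p) ^ n"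
proof -
  define M where "M n = (\<Sum>m\<in>I n. W m)" for n
  define D where "D k = (if k < N then E else 1)" for k
  \<comment> \<open>Each summand is one of the initial values to be dominated, so the bound holds
    for all \<open>n < N\<close>.\<close>
  define C where "C = (\<Sum>k<N. M k * E * (p / \<rho>) ^ k)"
  have M_nonneg: "0 \<le> M n" for n unfolding M_def by (intro sum_nonneg W)
  have pr: "0 < p / \<rho>" "0 < \<rho> / p" using p_pos \<open>0 < \<rho>\<close> by auto
  have C: "0 \<le> C" unfolding C_def
    using M_nonneg pr \<open>1 \<le> E\<close> by (intro sum_nonneg mult_nonneg_nonneg) auto
  have inv: "(p / \<rho>) ^ k * (\<rho> / p) ^ k = 1" for k
    using p_pos \<open>0 < \<rho>\<close> by (simp flip: power_mult_distrib)
  \<comment> \<open>The claim carries the factor \<open>D n\<close>, so the allowance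
    \<open>E\<close> is paid once, in the constant, and not again in the induction.\<close>
  have main: "M n * D n \<le> C * (\<rho> / p) ^ n" for n
  proof (induction n rule: less_induct)
    case (less n)
    show ?case
    proof (cases "n < N")
      case True
      have "M n * E * (p / \<rho>) ^ n \<le> C" unfolding C_def
        using M_nonneg pr \<open>1 \<le> E\<close> True
        by (intro member_le_sum mult_nonneg_nonneg) auto
      then have "M n * E * (p / \<rho>) ^ n * (\<rho> / p) ^ n \<le> C * (\<rho> / p) ^ n"
        using pr by (intro mult_right_mono) auto
      then show ?thesis using True by (simp add: D_def mult.assoc inv)
    next
      case False
      then have n: "N \<le> n" "5 \<le> n" using N_ge by auto
      have "M n = (\<Sum>k\<le>n - 5. \<Sum>x\<in>I k. W (c n + x))"
        unfolding M_def by (rule sum_I[OF n(1)])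
      also have "\<dots> \<le> (\<Sum>k\<le>n - 5. \<Sum>x\<in>I k. h (n - k) * (W x * D k))"
        unfolding D_def by (intro sum_mono step n) auto
      also have "\<dots> = (\<Sum>k\<le>n - 5. h (n - k) * (M k * D k))"
        by (simp add: M_def sum_distrib_left sum_distrib_right)
      also have "\<dots> \<le> (\<Sum>k\<le>n - 5. h (n - k) * (C * (\<rho> / p) ^ k))"
        using n by (intro sum_mono mult_left_mono less h) auto
      also have "\<dots> = (\<Sum>k\<le>n - 5. C * (\<rho> / p) ^ n * (h (n - k) * (p / \<rho>) ^ (n - k)))"
      proof (rule sum.cong)
        fix k assume "k \<in> {..n - 5}"
        then have "(\<rho> / p) ^ n = (\<rho> / p) ^ k * (\<rho> / p) ^ (n - k)"
          using n by (simp flip: power_add)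
        then show "h (n - k) * (C * (\<rho> / p) ^ k)
            = C * (\<rho> / p) ^ n * (h (n - k) * (p / \<rho>) ^ (n - k))"
          using inv[of "n - k"] by (simp add: mult_ac)
      qed simp
      also have "\<dots> = C * (\<rho> / p) ^ n * (\<Sum>k\<le>n - 5. h (n - k) * (p / \<rho>) ^ (n - k))"
        by (simp add: sum_distrib_left)
      also have "(\<Sum>k\<le>n - 5. h (n - k) * (p / \<rho>) ^ (n - k)) = (\<Sum>g\<in>{5..n}. h g * (p / \<rho>) ^ g)"
        by (rule sum.reindex_bij_witness[of _ "\<lambda>g. n - g" "\<lambda>k. n - k"]) (use n in auto)
      also have "C * (\<rho> / p) ^ n * \<dots> \<le> C * (\<rho> / p) ^ n * 1"
        using sum_h[of n] C pr by (intro mult_left_mono) auto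
      finally show ?thesis using False by (simp add: D_def)
    qed
  qed
  show thesis
  proof (rule that[OF C])
    fix n
    have "M n * 1 \<le> M n * D n"
      using \<open>1 \<le> E\<close> M_nonneg[of n] by (intro mult_left_mono) (auto simp: D_def)
    then show "(\<Sum>m\<in>I n. W m) \<le> C * (\<rho> / p) ^ n"
      using main[of n] by (simp add: M_def)
  qed
qed

text \<open>Because \<open>p + p ^ 5 = 1\<close>, the sequence \<open>(1 / p) ^ n\<close> solves the
  recurrence of \<open>c\<close>, so a positive lower bound for \<open>c n * p ^ n\<close> on the
  initial range propagates. It serves to turn bounds on cardinalities into bounds on
  proportions.\<close>

lemma card_I_lower:
  obtains \<kappa> :: real where "0 < \<kappa>" "\<And>n. \<kappa> \<le> real (card (I n)) * p ^ n"
proof -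
  define \<mu> where "\<mu> = Min ((\<lambda>k. real (c k) * p ^ k) ` {1..N})"
  define \<nu> where "\<nu> = Min ((\<lambda>k. real (card (I k)) * p ^ k) ` {..N})"
  have \<mu>: "0 < \<mu>" unfolding \<mu>_def
    using N_ge p_pos by (subst Min_gr_iff) (auto simp: c_pos)
  have \<nu>: "0 < \<nu>" unfolding \<nu>_def
    using p_pos by (subst Min_gr_iff) (auto simp: c_less)
  have c_lower: "\<mu> \<le> real (c n) * p ^ n" if "1 \<le> n" for n
    using that
  proof (induction n rule: less_induct)
    case (less n)
    show ?case
    proof (cases "n \<le> N")
      case True
      then show ?thesis unfolding \<mu>_def using less.prems by (intro Min_le) auto
    next
      case False
      define k where "k = n - 1"
      have n: "n = Suc k" "N \<le> k" "5 \<le> k" using False N_ge by (auto simp: k_def)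
      have "p ^ Suc k = p ^ 5 * p ^ (k - 4)" using n by (simp flip: power_add)
      then have "real (c n) * p ^ n = p * (real (c k) * p ^ k) + p ^ 5 * (real (c (k - 4)) * p ^ (k - 4))"
        using n c_rec[of k] by (simp add: algebra_simps)
      moreover have "p * \<mu> \<le> p * (real (c k) * p ^ k)"
        using less.IH[of k] n p_pos by (intro mult_left_mono) auto
      moreover have "p ^ 5 * \<mu> \<le> p ^ 5 * (real (c (k - 4)) * p ^ (k - 4))"
        using less.IH[of "k - 4"] n p_pos by (intro mult_left_mono) auto
      moreover have "p * \<mu> + p ^ 5 * \<mu> = \<mu>"
        by (simp add: p_root algebra_simps)
      ultimately show ?thesis by linarith
    qed
  qed
  show thesis
  \<comment> \<open>Beyond \<open>N\<close> the interval \<open>I n\<close> has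
    \<open>c (n - 4)\<close> elements, and the shift by 4 costs the factor
    \<open>p ^ 4\<close>.\<close>
  proof (rule that[of "min \<nu> (\<mu> * p ^ 4)"])
    show "0 < min \<nu> (\<mu> * p ^ 4)" using \<mu> \<nu> p_pos by simp
    fix n
    show "min \<nu> (\<mu> * p ^ 4) \<le> real (card (I n)) * p ^ n"
    proof (cases "n \<le> N")
      case True
      then have "\<nu> \<le> real (card (I n)) * p ^ n" unfolding \<nu>_def by (intro Min_le) auto
      then show ?thesis by simp
    next
      case False
      then have n: "n = n - 4 + 4" "1 \<le> n - 4" using N_ge by auto
      have "\<mu> * p ^ 4 \<le> real (c (n - 4)) * p ^ (n - 4) * p ^ 4"
        using c_lower[OF n(2)] p_pos by (intro mult_right_mono) auto
      also have "\<dots> = real (c (n - 4)) * p ^ n"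
        by (metis (no_types) n(1) mult.assoc power_add)
      finally show ?thesis using False c_rec[of n] by simp
    qed
  qed
qed

lemma markov_card:
  fixes W :: "nat \<Rightarrow> real" and w :: real
  assumes "\<And>m. 0 \<le> W m"
  shows "card {m \<in> I n. w \<le> W m} * w \<le> (\<Sum>m\<in>I n. W m)"
proof -
  have "card {m \<in> I n. w \<le> W m} * w = (\<Sum>m\<in>{m \<in> I n. w \<le> W m}. w)" by simp
  also have "\<dots> \<le> (\<Sum>m\<in>{m \<in> I n. w \<le> W m}. W m)" by (intro sum_mono) auto
  also have "\<dots> \<le> (\<Sum>m\<in>I n. W m)" by (intro sum_mono2) (use assms in auto)
  finally show ?thesis .
qed

text \<open>Markov's inequality at level \<open>w ^ n\<close>. The moment grows like
  \<open>(\<rho> / p) ^ n\<close> and the interval at least like \<open>(1 / p) ^ n\<close>, so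
  \<open>p\<close> cancels and the proportion decays once \<open>\<rho> < w\<close>.\<close>

lemma exponential_tail:
  fixes W h :: "nat \<Rightarrow> real" and \<rho> E w :: real
  assumes W: "\<And>m. 0 \<le> W m" and h: "\<And>g. 0 \<le> h g" and \<rho>: "0 < \<rho>" "1 \<le> E" and "0 < w"
    and step: "\<And>n k x. \<lbrakk>N \<le> n; k \<le> n - 5; x \<in> I k\<rbrakk> \<Longrightarrow>
                 W (c n + x) \<le> h (n - k) * (W x * (if k < N then E else 1))"
    and sum_h: "\<And>n. (\<Sum>g\<in>{5..n}. h g * (p / \<rho>) ^ g) \<le> 1"
  obtains C :: real where "0 \<le> C"
    "\<And>n. card {m \<in> I n. w ^ n \<le> W m} \<le> C * (\<rho> / w) ^ n * card (I n)"
proof -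
  obtain C :: real where C: "0 \<le> C" "\<And>n. (\<Sum>m\<in>I n. W m) \<le> C * (\<rho> / p) ^ n"
    using exponential_moment_bound[OF W h \<rho> step sum_h] by blast
  obtain \<kappa> where \<kappa>: "0 < \<kappa>" "\<And>n. \<kappa> \<le> real (card (I n)) * p ^ n"
    using card_I_lower by blast
  show thesis
  proof (rule that[of "C / \<kappa>"])
    show "0 \<le> C / \<kappa>" using C \<kappa> by simp
    fix n
    have "card {m \<in> I n. w ^ n \<le> W m} * w ^ n \<le> C * (\<rho> / p) ^ n"
      using markov_card[of W n "w ^ n"] W C(2)[of n] by fastforce
    also have "\<dots> \<le> C * (\<rho> / p) ^ n * (real (card (I n)) * p ^ n / \<kappa>)"
    proof -
      have "1 \<le> real (card (I n)) * p ^ n / \<kappa>"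
        using \<kappa>(1) \<kappa>(2)[of n] by (simp del: card_atLeastLessThan)
      moreover have "0 \<le> C * (\<rho> / p) ^ n" using C(1) \<rho>(1) p_pos by simp
      ultimately show ?thesis
        using mult_left_mono[of 1 "real (card (I n)) * p ^ n / \<kappa>" "C * (\<rho> / p) ^ n"]
        by (simp only: mult_1_right)
    qed
    also have "\<dots> = (C / \<kappa> * (\<rho> / w) ^ n * card (I n)) * w ^ n"
      using p_pos \<open>0 < w\<close> by (simp add: power_divide)
    finally show "card {m \<in> I n. w ^ n \<le> W m} \<le> C / \<kappa> * (\<rho> / w) ^ n * card (I n)"
      by (rule mult_right_le_imp_le) (use \<open>0 < w\<close> in simp)
  qed
qed

section \<open>The effect of prepending one index\<close>

lemma dec_shift:
  assumes "N \<le> n" "k \<le> n - 5" "x \<in> I k"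
  shows "dec (c n + x) = n # dec x"
proof -
  have "c (Suc k) \<le> c (n - 4)" using assms N_ge by (intro c_mono) auto
  then have "c n + x \<in> I n" using assms c_rec[of n] by auto
  then show ?thesis using dec_rec[OF assms(1)] by simp
qed

lemma gaps_dec_large:
  assumes "N \<le> n" "k \<le> n - 5" "x \<in> I k" "N \<le> k"
  shows "gaps (dec (c n + x)) = (n - k) # gaps (dec x)"
  using dec_shift[OF assms(1-3)] dec_rec[OF assms(4,3)] by (simp add: gaps_Cons_Cons)

text \<open>
  The error 2 for small \<open>k\<close> is needed because \<open>dec x\<close> need not start with \<open>k\<close> (or be nonempty) there.
\<close>

lemma gap_dev_step:
  assumes "N \<le> n" "k \<le> n - 5" "x \<in> I k" "\<bar>\<sigma>\<bar> = 1"
  shows "\<sigma> * gap_dev g (c n + x)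
    \<le> \<sigma> * (of_bool (n - k = g) - P g) + \<sigma> * gap_dev g x + (if k < N then 2 else 0)"
proof (cases "k < N")
  case False
  then have "gap_dev g (c n + x) = (of_bool (n - k = g) - P g) + gap_dev g x"
    using gaps_dec_large[OF assms(1-3)] by (simp add: gap_dev_def algebra_simps)
  then show ?thesis using False by (simp only: distrib_left if_False)
next
  case True
  \<comment> \<open>The true increment and the nominal one,
    \<open>of_bool (n - k = g) - P g\<close>, are each at most 1 in absolute value, so they differ
    by at most 2.\<close>
  have "\<bar>gap_dev g (c n + x) - gap_dev g x\<bar> \<le> 1"
  proof (cases "dec x")
    case Nil
    then show ?thesis
      using dec_shift[OF assms(1-3)] by (simp add: gap_dev_def gaps_def)
  next
    case (Cons a as)
    then have "gap_dev g (c n + x) - gap_dev g x = of_bool (n - a = g) - P g"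
      using dec_shift[OF assms(1-3)] by (simp add: gap_dev_def gaps_Cons_Cons algebra_simps)
    then show ?thesis using P_nonneg[of g] P_le_1[of g] by (auto split: if_splits)
  qed
  moreover have "\<bar>of_bool (n - k = g) - P g\<bar> \<le> 1"
    using P_nonneg[of g] P_le_1[of g] by auto
  ultimately have "\<bar>\<sigma> * (gap_dev g (c n + x) - gap_dev g x)\<bar> \<le> 1"
    "\<bar>\<sigma> * (of_bool (n - k = g) - P g)\<bar> \<le> 1"
    by (simp_all only: abs_mult assms mult_1)
  then show ?thesis using True by (simp only: right_diff_distrib if_True)
qed

section \<open>Chernoff bounds for the gap deviation\<close>

lemma sum_p_power_le_1: "(\<Sum>d\<in>{5..n}. p ^ d) \<le> 1"
  using sum_power_from_5_le[OF p_pos p_less_1, of n] p_root p_less_1 by simp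

text \<open>Over all \<open>d \<ge> 5\<close> the centred sum vanishes, as \<open>P\<close> is a
  probability law. Truncation at \<open>n\<close> therefore leaves at most the missing mass.\<close>

lemma centred_sum_bound:
  "\<bar>\<Sum>d\<in>{5..n}. p ^ d * (of_bool (d = g) - P g)\<bar> \<le> 1 - (\<Sum>d\<in>{5..n}. p ^ d)"
proof -
  define A where "A = (\<Sum>d\<in>{5..n}. p ^ d)"
  have A: "0 \<le> A" "A \<le> 1"
    unfolding A_def using sum_p_power_le_1 p_pos by (auto intro!: sum_nonneg)
  have "(\<Sum>d\<in>{5..n}. p ^ d * (of_bool (d = g) - P g))
      = (\<Sum>d\<in>{5..n}. if d = g then p ^ g else 0) - P g * A"
    unfolding A_def sum_distrib_left sum_subtractf[symmetric]
    by (intro sum.cong) (auto simp: algebra_simps)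
  also have "(\<Sum>d\<in>{5..n}. if d = g then p ^ g else 0) = (if g \<in> {5..n} then p ^ g else 0)"
    by (simp add: sum.delta)
  finally have eq: "(\<Sum>d\<in>{5..n}. p ^ d * (of_bool (d = g) - P g))
      = (if g \<in> {5..n} then p ^ g else 0) - P g * A" .
  show ?thesis
  \<comment> \<open>If \<open>g\<close> is cut off, the sum is \<open>- P g * A\<close> and
    \<open>P g\<close> is part of the missing mass; otherwise it is \<open>P g * (1 - A)\<close>,
    which is 0 for \<open>g < 5\<close>.\<close>
  proof (cases "5 \<le> g \<and> n < g")
    case True
    have "A + p ^ g = (\<Sum>d\<in>insert g {5..n}. p ^ d)"
      unfolding A_def using True by simp
    also have "\<dots> \<le> (\<Sum>d\<in>{5..g}. p ^ d)"
      using True p_pos by (intro sum_mono2) auto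
    also have "\<dots> \<le> 1" by (rule sum_p_power_le_1)
    finally have "P g \<le> 1 - A" using True by (simp add: limit_gap_prob_def)
    moreover have "P g * A \<le> P g" "0 \<le> P g * A"
      using A P_nonneg[of g] by (auto intro: mult_left_le)
    ultimately show ?thesis using True eq unfolding A_def[symmetric] by simp
  next
    case False
    then have "(if g \<in> {5..n} then p ^ g else 0) - P g * A = P g * (1 - A)"
      by (auto simp: limit_gap_prob_def algebra_simps)
    moreover have "0 \<le> P g * (1 - A)" "P g * (1 - A) \<le> 1 - A"
      using A P_nonneg[of g] P_le_1[of g] by (auto intro: mult_left_le_one_le)
    ultimately show ?thesis using eq unfolding A_def[symmetric] by simp
  qed
qed

text \<open>The kernel condition of \<open>exponential_tail\<close> with
  \<open>\<rho> = exp (s\<^sup>2)\<close>. Centring removes the linear term up to truncation, and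
  the quadratic one is absorbed since \<open>1 + s\<^sup>2 \<le> exp (s\<^sup>2)\<close>.\<close>

lemma centred_exponential_sum:
  assumes "0 \<le> s" "s \<le> 1" "\<bar>\<sigma>\<bar> = 1"
  shows "(\<Sum>d\<in>{5..n}. exp (s * (\<sigma> * (of_bool (d = g) - P g))) * (p / exp (s\<^sup>2)) ^ d) \<le> 1"
proof -
  define f where "f d = \<sigma> * (of_bool (d = g) - P g)" for d
  have f: "\<bar>f d\<bar> \<le> 1" for d
    unfolding f_def abs_mult assms using P_nonneg[of g] P_le_1[of g] by auto
  define A where "A = (\<Sum>d\<in>{5..n}. p ^ d)"
  have A: "0 \<le> A" "A \<le> 1"
    unfolding A_def using sum_p_power_le_1 p_pos by (auto intro!: sum_nonneg)
  have term_le: "exp (s * f d) * (p / exp (s\<^sup>2)) ^ d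
      \<le> exp (- s\<^sup>2) * ((1 + s\<^sup>2) * p ^ d + s * (p ^ d * f d))" if "d \<in> {5..n}" for d
  proof -
    have "\<bar>s * f d\<bar> \<le> s" using f[of d] assms by (simp add: abs_mult mult_left_le)
    then have sf: "\<bar>s * f d\<bar> \<le> 1" "(s * f d)\<^sup>2 \<le> s\<^sup>2"
      using assms by (auto simp: abs_le_square_iff[symmetric])
    have "exp (s * f d) \<le> 1 + s * f d + s\<^sup>2"
      using exp_le_quadratic[OF sf(1)] sf(2) by simp
    \<comment> \<open>Of the \<open>d\<close> damping factors \<open>exp (- s\<^sup>2)\<close> one
      is kept, which suffices.\<close>
    moreover have "(p / exp (s\<^sup>2)) ^ d \<le> exp (- s\<^sup>2) * p ^ d"
    proof -
      have "exp (s\<^sup>2) ^ 1 \<le> exp (s\<^sup>2) ^ d"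
        using that by (intro power_increasing) auto
      then show ?thesis using p_pos
        by (simp add: power_divide exp_minus divide_simps mult_left_mono)
    qed
    ultimately have "exp (s * f d) * (p / exp (s\<^sup>2)) ^ d
        \<le> (1 + s * f d + s\<^sup>2) * (exp (- s\<^sup>2) * p ^ d)"
      using p_pos
      by (intro mult_mono) (auto intro: order.trans[OF exp_ge_zero])
    then show ?thesis by (simp add: algebra_simps)
  qed
  have "(\<Sum>d\<in>{5..n}. exp (s * f d) * (p / exp (s\<^sup>2)) ^ d)
      \<le> (\<Sum>d\<in>{5..n}. exp (- s\<^sup>2) * ((1 + s\<^sup>2) * p ^ d + s * (p ^ d * f d)))"
    by (intro sum_mono term_le)
  also have "\<dots> = exp (- s\<^sup>2) * ((1 + s\<^sup>2) * A + s * (\<Sum>d\<in>{5..n}. p ^ d * f d))"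
    unfolding A_def sum_distrib_left[symmetric] sum.distrib by simp
  \<comment> \<open>The missing mass \<open>1 - A\<close> pays for the truncated linear term,
    because \<open>s \<le> 1\<close>.\<close>
  also have "\<dots> \<le> exp (- s\<^sup>2) * (1 + s\<^sup>2)"
  proof (intro mult_left_mono)
    have "(\<Sum>d\<in>{5..n}. p ^ d * f d) = \<sigma> * (\<Sum>d\<in>{5..n}. p ^ d * (of_bool (d = g) - P g))"
      unfolding sum_distrib_left by (intro sum.cong) (auto simp: f_def)
    then have "\<bar>\<Sum>d\<in>{5..n}. p ^ d * f d\<bar> \<le> 1 - A"
      using centred_sum_bound[of g n] assms by (simp add: abs_mult A_def)
    then have "(\<Sum>d\<in>{5..n}. p ^ d * f d) \<le> 1 - A" by simp
    then have "s * (\<Sum>d\<in>{5..n}. p ^ d * f d) \<le> s * (1 - A)"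
      using assms by (intro mult_left_mono)
    also have "\<dots> \<le> 1 - A" using assms A by (simp add: mult_left_le_one_le)
    finally show "(1 + s\<^sup>2) * A + s * (\<Sum>d\<in>{5..n}. p ^ d * f d) \<le> 1 + s\<^sup>2"
      using mult_left_mono[OF A(2), of "s\<^sup>2"] by (simp add: algebra_simps)
  qed simp
  also have "\<dots> \<le> exp (- s\<^sup>2) * exp (s\<^sup>2)"
    by (intro mult_left_mono) auto
  finally show ?thesis by (simp add: f_def exp_minus)
qed

text \<open>The sign \<open>\<sigma>\<close> lets one argument serve both the upper and the lower
  tail.\<close>

lemma signed_gap_dev_tail:
  assumes "0 < \<epsilon>" "\<epsilon> \<le> 1" "\<bar>\<sigma>\<bar> = 1"
  obtains C :: real where "0 \<le> C"
    "\<And>n. card {m \<in> I n. \<epsilon> * n \<le> \<sigma> * gap_dev g m} \<le> C * exp (- (\<epsilon>\<^sup>2 / 4)) ^ n * card (I n)"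
proof -
  \<comment> \<open>This value minimises the exponent \<open>s\<^sup>2 - s * \<epsilon>\<close>,
    with minimum \<open>- (\<epsilon>\<^sup>2 / 4)\<close>.\<close>
  define s where "s = \<epsilon> / 2"
  have s: "0 < s" "s \<le> 1" using assms by (auto simp: s_def)
  define W where "W m = exp (s * (\<sigma> * gap_dev g m))" for m
  define h where "h d = exp (s * (\<sigma> * (of_bool (d = g) - P g)))" for d
  \<comment> \<open>The allowance \<open>exp (2 * s)\<close> is the exponential of the error 2 in
    \<open>gap_dev_step\<close>.\<close>
  have step: "W (c n + x) \<le> h (n - k) * (W x * (if k < N then exp (2 * s) else 1))"
    if "N \<le> n" "k \<le> n - 5" "x \<in> I k" for n k x
    using mult_left_mono[OF gap_dev_step[OF that assms(3), of g], of s] s(1)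
    unfolding W_def h_def by (auto simp flip: exp_add simp: algebra_simps)
  obtain C :: real where C: "0 \<le> C"
    "\<And>n. card {m \<in> I n. exp (s * \<epsilon>) ^ n \<le> W m} \<le> C * (exp (s\<^sup>2) / exp (s * \<epsilon>)) ^ n * card (I n)"
    by (rule exponential_tail[of W h "exp (s\<^sup>2)" "exp (2 * s)" "exp (s * \<epsilon>)"])
       (use s step centred_exponential_sum[OF less_imp_le[OF s(1)] s(2) assms(3)] in
          \<open>auto simp: W_def h_def\<close>)
  have "exp (s\<^sup>2) / exp (s * \<epsilon>) = exp (- (\<epsilon>\<^sup>2 / 4))"
    by (simp add: s_def power2_eq_square flip: exp_diff)
  moreover have "exp (s * \<epsilon>) ^ n \<le> W m \<longleftrightarrow> \<epsilon> * n \<le> \<sigma> * gap_dev g m" for n m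
  proof -
    have "exp (s * \<epsilon>) ^ n = exp (s * (\<epsilon> * n))"
      by (simp add: mult_ac flip: exp_of_nat_mult)
    then show ?thesis using s(1) by (simp only: W_def exp_le_cancel_iff mult_le_cancel_left_pos)
  qed
  ultimately show thesis using C that by simp
qed

lemma gap_dev_tail:
  assumes "0 < \<epsilon>"
  obtains C r :: real where "0 \<le> C" "0 < r" "r < 1"
    "\<And>n. card {m \<in> I n. \<epsilon> * n \<le> \<bar>gap_dev g m\<bar>} \<le> C * r ^ n * card (I n)"
proof -
  \<comment> \<open>The Chernoff bound is available only up to 1; lowering the threshold enlarges
    the event.\<close>
  define \<delta> where "\<delta> = min \<epsilon> 1"
  have \<delta>: "0 < \<delta>" "\<delta> \<le> 1" "\<delta> \<le> \<epsilon>" using assms by (auto simp: \<delta>_def)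
  define r where "r = exp (- (\<delta>\<^sup>2 / 4))"
  obtain C :: real where C: "0 \<le> C"
    "\<And>n. card {m \<in> I n. \<delta> * n \<le> 1 * gap_dev g m} \<le> C * r ^ n * card (I n)"
    unfolding r_def using signed_gap_dev_tail[OF \<delta>(1,2), of 1 g] by auto
  obtain D :: real where D: "0 \<le> D"
    "\<And>n. card {m \<in> I n. \<delta> * n \<le> - 1 * gap_dev g m} \<le> D * r ^ n * card (I n)"
    unfolding r_def using signed_gap_dev_tail[OF \<delta>(1,2), of "- 1" g] by auto
  show thesis
  proof (rule that[of "C + D" r])
    show "0 < r" "r < 1" using \<delta> by (auto simp: r_def)
    fix n :: nat
    have "\<delta> * n \<le> \<epsilon> * n" using \<delta> by (intro mult_right_mono) auto
    then have "card {m \<in> I n. \<epsilon> * n \<le> \<bar>gap_dev g m\<bar>}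
        \<le> card ({m \<in> I n. \<delta> * n \<le> 1 * gap_dev g m} \<union> {m \<in> I n. \<delta> * n \<le> - 1 * gap_dev g m})"
      by (intro card_mono) auto
    also have "\<dots> \<le> card {m \<in> I n. \<delta> * n \<le> 1 * gap_dev g m} + card {m \<in> I n. \<delta> * n \<le> - 1 * gap_dev g m}"
      by (rule card_Un_le)
    finally show "card {m \<in> I n. \<epsilon> * n \<le> \<bar>gap_dev g m\<bar>} \<le> (C + D) * r ^ n * card (I n)"
      using C(2)[of n] D(2)[of n] by (simp add: algebra_simps)
  qed (use C D in auto)
qed

lemma few_gaps_tail:
  obtains \<alpha> C r :: real where "0 < \<alpha>" "0 \<le> C" "0 < r" "r < 1"
    "\<And>n. card {m \<in> I n. ngaps m \<le> \<alpha> * n} \<le> C * r ^ n * card (I n)"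
proof -
  \<comment> \<open>For \<open>W = 2\<^sup>-\<^sup>T\<close> the renewal inequality with rate \<open>\<rho> = p / v\<close> is exactly \<open>v ^ 5 / (1 - v) \<le> 2\<close>.\<close>
  obtain v where v: "p < v" "v < 1" "v ^ 5 = 2 * (1 - v)"
    using exists_root_scaled[of p 2] p_pos p_less_1 p_root by auto
  define \<rho> where "\<rho> = p / v"
  have \<rho>: "0 < \<rho>" "\<rho> < 1" "p / \<rho> = v" using v p_pos by (auto simp: \<rho>_def)
  define W :: "nat \<Rightarrow> real" where "W m = (1 / 2) ^ ngaps m" for m
  \<comment> \<open>Chosen so that \<open>2 powr (- \<alpha>) = sqrt \<rho>\<close>. The level
    \<open>sqrt \<rho>\<close> lies strictly between \<open>\<rho>\<close> and 1, so the tail ratio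
    \<open>\<rho> / sqrt \<rho>\<close> is below 1.\<close>
  define \<alpha> where "\<alpha> = - log 2 (sqrt \<rho>)"
  have \<alpha>: "0 < \<alpha>" using \<rho> by (simp add: \<alpha>_def)
  have step: "W (c n + x) \<le> 1 / 2 * (W x * (if k < N then 2 else 1))"
    if "N \<le> n" "k \<le> n - 5" "x \<in> I k" for n k x
  proof (cases "k < N")
    case True
    \<comment> \<open>For small \<open>k\<close> the allowance 2 cancels the factor
      \<open>1 / 2\<close>, so it is enough that no gap is lost.\<close>
    have "ngaps x \<le> ngaps (c n + x)"
      using dec_shift[OF that] by (simp add: length_gaps)
    then show ?thesis using True by (simp add: W_def power_decreasing)
  qed (use gaps_dec_large[OF that] in \<open>simp add: W_def\<close>)
  have sum_h: "(\<Sum>g\<in>{5..n}. 1 / 2 * (p / \<rho>) ^ g) \<le> 1" for n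
  proof -
    have "v ^ 5 / (1 - v) = 2" using v by (simp add: nonzero_divide_eq_eq)
    then show ?thesis
      using sum_power_from_5_le[of v n] v p_pos unfolding \<rho>(3)
      by (simp flip: sum_divide_distrib)
  qed
  obtain C :: real where C: "0 \<le> C"
    "\<And>n. card {m \<in> I n. sqrt \<rho> ^ n \<le> W m} \<le> C * (\<rho> / sqrt \<rho>) ^ n * card (I n)"
    by (rule exponential_tail[of W "\<lambda>_. 1 / 2" \<rho> 2 "sqrt \<rho>"])
       (use \<rho> step sum_h in \<open>auto simp: W_def\<close>)
  show thesis
  proof (rule that[OF \<alpha> C(1)])
    show "0 < sqrt \<rho>" "sqrt \<rho> < 1" using \<rho> by auto
    fix n :: nat
    have "sqrt \<rho> ^ n \<le> W m" if "ngaps m \<le> \<alpha> * n" for m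
    proof -
      have "sqrt \<rho> = 2 powr (- \<alpha>)" using \<rho> by (simp add: \<alpha>_def)
      then have "sqrt \<rho> ^ n = 2 powr (- (\<alpha> * n))"
        by (simp add: powr_powr flip: powr_realpow)
      also have "\<dots> \<le> 2 powr (- real (ngaps m))" using that by simp
      also have "\<dots> = W m" by (simp add: W_def powr_minus powr_realpow power_one_over inverse_eq_divide)
      finally show ?thesis .
    qed
    then have "card {m \<in> I n. ngaps m \<le> \<alpha> * n} \<le> card {m \<in> I n. sqrt \<rho> ^ n \<le> W m}"
      by (intro card_mono) auto
    moreover have "\<rho> / sqrt \<rho> = sqrt \<rho>" using \<rho> by (simp add: real_div_sqrt)
    ultimately show "card {m \<in> I n. ngaps m \<le> \<alpha> * n} \<le> C * sqrt \<rho> ^ n * card (I n)"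
      using C(2)[of n] by simp
  qed
qed

text \<open>Every step adds at most one gap and lowers the index; the constant covers all numbers
  below \<open>c N\<close> at once.\<close>

lemma ngaps_upper:
  obtains K where "\<And>n m. m \<in> I n \<Longrightarrow> ngaps m \<le> K + n"
proof
  fix n m
  show "m \<in> I n \<Longrightarrow> ngaps m \<le> (\<Sum>x<c N. ngaps x) + n"
  proof (induction m arbitrary: n rule: less_induct)
    case (less m)
    show ?case
    proof (cases "n < N")
      case True
      then have "m < c N" using less.prems c_mono[of "Suc n" N] by auto
      then have "ngaps m \<le> (\<Sum>x<c N. ngaps x)"
        by (intro member_le_sum) auto
      then show ?thesis by simp
    next
      case False
      then have n: "N \<le> n" "5 \<le> n" using N_ge by auto
      define x where "x = m - c n"
      have "x < c (n - 4)" using less.prems c_rec[OF n(1)] by (auto simp: x_def)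
      then obtain k where k: "k < n - 4" "x \<in> I k" using index_exists by blast
      have "x < m" using c_pos[of n] n less.prems by (auto simp: x_def)
      from less.IH[OF this k(2)] have "ngaps x \<le> (\<Sum>x<c N. ngaps x) + k" .
      moreover have "ngaps m \<le> Suc (ngaps x)"
        using dec_rec[OF n(1) less.prems] by (simp add: length_gaps x_def)
      ultimately show ?thesis using k(1) by linarith
    qed
  qed
qed

text \<open>With more than \<open>\<alpha> * n\<close> gaps, an error \<open>\<epsilon>\<close> in
  the ratio forces a deviation of at least \<open>\<epsilon> * \<alpha> * n\<close>. Numbers without
  gaps, where the quotient is 0 by convention, fall into the few-gaps event.\<close>

lemma gap_ratio_tail:
  assumes "0 < \<epsilon>"
  obtains C r :: real where "0 \<le> C" "0 < r" "r < 1"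
    "\<And>n. card {m \<in> I n. \<epsilon> \<le> \<bar>count_list (gaps (dec m)) g / ngaps m - P g\<bar>} \<le> C * r ^ n * card (I n)"
proof -
  obtain \<alpha> C r :: real where few: "0 < \<alpha>" "0 \<le> C" "0 < r" "r < 1"
    "\<And>n. card {m \<in> I n. ngaps m \<le> \<alpha> * n} \<le> C * r ^ n * card (I n)"
    by (rule few_gaps_tail) (rule that)
  obtain D s :: real where dev: "0 \<le> D" "0 < s" "s < 1"
    "\<And>n. card {m \<in> I n. \<epsilon> * \<alpha> * n \<le> \<bar>gap_dev g m\<bar>} \<le> D * s ^ n * card (I n)"
    by (rule gap_dev_tail[of "\<epsilon> * \<alpha>" g]) (use assms few in auto)
  show thesis
  proof (rule that[of "C + D" "max r s"])
    fix n :: nat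
    have "\<epsilon> * \<alpha> * n \<le> \<bar>gap_dev g m\<bar>"
      if "\<not> ngaps m \<le> \<alpha> * n" "\<epsilon> \<le> \<bar>count_list (gaps (dec m)) g / ngaps m - P g\<bar>" for m
    proof -
      have "0 \<le> \<alpha> * n" using few by simp
      then have T: "0 < real (ngaps m)" using that(1) by linarith
      have "\<epsilon> * (\<alpha> * n) \<le> \<epsilon> * ngaps m"
        using that(1) assms by (intro mult_left_mono) auto
      also have "\<dots> \<le> \<bar>count_list (gaps (dec m)) g / ngaps m - P g\<bar> * ngaps m"
        using that(2) by (intro mult_right_mono) auto
      also have "\<dots> = \<bar>(count_list (gaps (dec m)) g / ngaps m - P g) * ngaps m\<bar>"
        by (simp add: abs_mult)
      also have "\<dots> = \<bar>gap_dev g m\<bar>"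
        using T by (simp add: gap_dev_def left_diff_distrib)
      finally show ?thesis by (simp add: mult.assoc)
    qed
    then have "card {m \<in> I n. \<epsilon> \<le> \<bar>count_list (gaps (dec m)) g / ngaps m - P g\<bar>}
        \<le> card ({m \<in> I n. ngaps m \<le> \<alpha> * n} \<union> {m \<in> I n. \<epsilon> * \<alpha> * n \<le> \<bar>gap_dev g m\<bar>})"
      by (intro card_mono) auto
    also have "\<dots> \<le> card {m \<in> I n. ngaps m \<le> \<alpha> * n} + card {m \<in> I n. \<epsilon> * \<alpha> * n \<le> \<bar>gap_dev g m\<bar>}"
      by (rule card_Un_le)
    finally have "real (card {m \<in> I n. \<epsilon> \<le> \<bar>count_list (gaps (dec m)) g / ngaps m - P g\<bar>})
        \<le> C * r ^ n * card (I n) + D * s ^ n * card (I n)"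
      using few(5)[of n] dev(4)[of n] by linarith
    also have "\<dots> \<le> C * max r s ^ n * card (I n) + D * max r s ^ n * card (I n)"
      using few dev by (intro add_mono mult_right_mono mult_left_mono power_mono) auto
    finally show "card {m \<in> I n. \<epsilon> \<le> \<bar>count_list (gaps (dec m)) g / ngaps m - P g\<bar>}
        \<le> (C + D) * max r s ^ n * card (I n)"
      by (simp add: algebra_simps)
  qed (use few dev in auto)
qed

end

section \<open>Averaged and almost sure limits\<close>

lemma cdf_nat_point_measure:
  assumes "\<And>g. 0 \<le> w g"
  shows "cdf (nat_point_measure w) x = (\<Sum>g | real g \<le> x. w g)"
proof -
  have fin: "finite {g. real g \<le> x}"
    by (rule finite_subset[of _ "{..nat \<lfloor>x\<rfloor>}"]) (auto simp: le_nat_floor)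
  have "emeasure (nat_point_measure w) {..x}
      = emeasure (density (count_space UNIV) (\<lambda>g. ennreal (w g))) {g. real g \<le> x}"
    unfolding nat_point_measure_def by (subst emeasure_distr) (auto simp: vimage_def)
  also have "\<dots> = (\<integral>\<^sup>+g. ennreal (w g) * indicator {g. real g \<le> x} g \<partial>count_space UNIV)"
    by (subst emeasure_density) auto
  also have "\<dots> = (\<integral>\<^sup>+g. ennreal (w g) \<partial>count_space {g. real g \<le> x})"
    by (subst nn_integral_count_space_indicator) auto
  also have "\<dots> = (\<Sum>g | real g \<le> x. ennreal (w g))"
    by (rule nn_integral_count_space_finite[OF fin])
  also have "\<dots> = ennreal (\<Sum>g | real g \<le> x. w g)"
    using assms by (intro sum_ennreal) auto
  finally show ?thesis
    using assms by (simp add: cdf_def measure_def sum_nonneg)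
qed

text \<open>The distribution function at any point is a finite sum of weights, so it converges along
  with them.\<close>

lemma weak_conv_m_nat_point_measure:
  assumes "\<And>n g. 0 \<le> w n g" "\<And>g. (\<lambda>n. w n g) \<longlonglongrightarrow> v g"
  shows "weak_conv_m (\<lambda>n. nat_point_measure (w n)) (nat_point_measure v)"
proof -
  have "0 \<le> v g" for g
    by (rule LIMSEQ_le_const[OF assms(2)]) (use assms(1) in auto)
  then show ?thesis
    unfolding weak_conv_m_def weak_conv_def using assms
    by (auto simp: cdf_nat_point_measure intro!: tendsto_sum)
qed

context gap_scheme
begin

section \<open>Limits of the averaged fractions and of the individual ratios\<close>

lemma card_I_pos: "0 < card (I n)"
  using c_less[of n] by simp

lemma abs_gap_dev_le: "\<bar>gap_dev g m\<bar> \<le> ngaps m"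
proof -
  have "real (count_list (gaps (dec m)) g) \<le> ngaps m"
    by (simp add: count_le_length)
  moreover have "0 \<le> P g * ngaps m" "P g * ngaps m \<le> ngaps m"
    using P_nonneg[of g] P_le_1[of g] by (auto intro: mult_left_le_one_le)
  ultimately show ?thesis unfolding gap_dev_def by linarith
qed

text \<open>The error equals the sum of \<open>gap_dev g\<close> over \<open>I n\<close> divided by
  the total number of gaps. Typical numbers contribute at most \<open>\<epsilon> / 2\<close> per
  gap; the exponentially few others have only linearly many gaps.\<close>

lemma gap_frac_tendsto: "(\<lambda>n. gap_frac c dec n g) \<longlonglongrightarrow> P g"
proof (rule LIMSEQ_I)
  fix \<epsilon> :: real assume "0 < \<epsilon>"
  obtain C r :: real where bad: "0 \<le> C" "0 < r" "r < 1"
    "\<And>n. card {m \<in> I n. \<epsilon> / 2 \<le> \<bar>count_list (gaps (dec m)) g / ngaps m - P g\<bar>} \<le> C * r ^ n * card (I n)"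
    by (rule gap_ratio_tail[of "\<epsilon> / 2" g]) (use \<open>0 < \<epsilon>\<close> in \<open>auto intro: that\<close>)
  obtain \<alpha> D s :: real where few: "0 < \<alpha>" "0 \<le> D" "0 < s" "s < 1"
    "\<And>n. card {m \<in> I n. ngaps m \<le> \<alpha> * n} \<le> D * s ^ n * card (I n)"
    by (rule few_gaps_tail) (rule that)
  obtain K where K: "\<And>n m. m \<in> I n \<Longrightarrow> ngaps m \<le> K + n"
    by (rule ngaps_upper) (rule that)
  \<comment> \<open>The contribution of the atypical numbers relative to the lower bound for the
    total; the factor \<open>n\<close> has cancelled, using
    \<open>K + n \<le> (K + 1) * n\<close>.\<close>
  define b where "b n = C * r ^ n * (K + 1) / (\<alpha> * (1 - D * s ^ n))" for n
  have frac_bound: "\<bar>gap_frac c dec n g - P g\<bar> \<le> \<epsilon> / 2 + b n"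
    if n: "0 < n" "D * s ^ n < 1" for n
  proof -
    define B where "B = {m \<in> I n. \<epsilon> / 2 \<le> \<bar>count_list (gaps (dec m)) g / ngaps m - P g\<bar>}"
    define F where "F = {m \<in> I n. ngaps m \<le> \<alpha> * n}"
    define T where "T = real (\<Sum>m\<in>I n. ngaps m)"
    define q where "q = real (card (I n))"
    have q: "0 < q" using card_I_pos[of n] by (simp add: q_def)
    \<comment> \<open>All but a proportion \<open>D * s ^ n\<close> of the interval have more than
      \<open>\<alpha> * n\<close> gaps.\<close>
    have "\<alpha> * n * (1 - D * s ^ n) * q \<le> \<alpha> * n * (q - card F)"
      using few(1) few(5)[of n] unfolding F_def[symmetric] q_def[symmetric] mult.assoc
      by (intro mult_left_mono) (auto simp: algebra_simps)
    also have "q - card F = card (I n - F)"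
    proof -
      have "F \<subseteq> I n" "finite F" by (auto simp: F_def)
      then show ?thesis
        unfolding q_def by (simp only: card_Diff_subset of_nat_diff card_mono finite_atLeastLessThan)
    qed
    also have "\<alpha> * n * card (I n - F) = (\<Sum>m\<in>I n - F. \<alpha> * n)" by simp
    also have "\<dots> \<le> (\<Sum>m\<in>I n - F. real (ngaps m))"
      by (intro sum_mono) (auto simp: F_def)
    also have "\<dots> \<le> T" unfolding T_def of_nat_sum by (intro sum_mono2) auto
    finally have T: "\<alpha> * n * (1 - D * s ^ n) * q \<le> T" .
    have T_pos: "0 < \<alpha> * n * (1 - D * s ^ n) * q" using few n q by simp
    have dev: "\<bar>gap_dev g m\<bar> \<le> \<epsilon> / 2 * ngaps m + (if m \<in> B then real (K + n) else 0)"
      if "m \<in> I n" for m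
    proof (cases "m \<in> B")
      case True
      have "\<bar>gap_dev g m\<bar> \<le> real (K + n)"
        using abs_gap_dev_le[of g m] K[OF that] by linarith
      then show ?thesis using True \<open>0 < \<epsilon>\<close> by (simp add: add_increasing)
    next
      case False
      show ?thesis
      proof (cases "ngaps m = 0")
        case True
        then show ?thesis using abs_gap_dev_le[of g m] False by simp
      next
        case nz: False
        then have "gap_dev g m = (count_list (gaps (dec m)) g / ngaps m - P g) * ngaps m"
          by (simp add: gap_dev_def left_diff_distrib)
        then have "\<bar>gap_dev g m\<bar> = \<bar>count_list (gaps (dec m)) g / ngaps m - P g\<bar> * ngaps m"
          by (simp add: abs_mult)
        also have "\<dots> \<le> \<epsilon> / 2 * ngaps m"
          using False that by (intro mult_right_mono) (auto simp: B_def)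
        finally show ?thesis using False by simp
      qed
    qed
    have "\<bar>\<Sum>m\<in>I n. gap_dev g m\<bar> \<le> (\<Sum>m\<in>I n. \<bar>gap_dev g m\<bar>)" by (rule sum_abs)
    also have "\<dots> \<le> (\<Sum>m\<in>I n. \<epsilon> / 2 * ngaps m + (if m \<in> B then real (K + n) else 0))"
      by (intro sum_mono dev)
    also have "\<dots> = \<epsilon> / 2 * T + (\<Sum>m\<in>I n. if m \<in> B then real (K + n) else 0)"
      by (simp add: sum.distrib T_def sum_distrib_left)
    also have "(\<Sum>m\<in>I n. if m \<in> B then real (K + n) else 0) = card B * real (K + n)"
    proof -
      have "I n \<inter> B = B" by (auto simp: B_def)
      then show ?thesis
        by (simp only: sum.inter_restrict[symmetric] finite_atLeastLessThan sum_constant)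
    qed
    also have "\<dots> \<le> (C * r ^ n * q) * (real (K + 1) * n)"
    proof (intro mult_mono)
      show "real (card B) \<le> C * r ^ n * q" using bad(4)[of n] by (simp add: B_def q_def)
      have "K * 1 \<le> K * n" using n by (intro mult_left_mono) auto
      then have "K + n \<le> (K + 1) * n" by simp
      then show "real (K + n) \<le> real (K + 1) * n" by (simp only: of_nat_le_iff flip: of_nat_mult)
    qed (use bad q in auto)
    also have "\<dots> = b n * (\<alpha> * n * (1 - D * s ^ n) * q)"
      using few n by (simp add: b_def)
    also have "\<dots> \<le> b n * T"
      using T bad few n by (intro mult_left_mono) (auto simp: b_def)
    finally have "\<bar>\<Sum>m\<in>I n. gap_dev g m\<bar> \<le> (\<epsilon> / 2 + b n) * T"
      by (simp add: algebra_simps)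
    moreover have "gap_frac c dec n g - P g = (\<Sum>m\<in>I n. gap_dev g m) / T"
      using T T_pos
      by (simp add: gap_frac_def gap_dev_def T_def sum_subtractf diff_divide_distrib
            flip: sum_distrib_left)
    ultimately show ?thesis using T T_pos by (simp add: abs_div divide_le_eq)
  qed
  have "(\<lambda>n. D * s ^ n) \<longlonglongrightarrow> D * 0"
    using few by (intro tendsto_intros LIMSEQ_power_zero) auto
  then have ev1: "\<forall>\<^sub>F n in sequentially. D * s ^ n < 1"
    by (rule order_tendstoD) simp
  have "b \<longlonglongrightarrow> C * 0 * (K + 1) / (\<alpha> * (1 - D * 0))"
    unfolding b_def using few bad by (intro tendsto_intros LIMSEQ_power_zero) auto
  then have ev2: "\<forall>\<^sub>F n in sequentially. b n < \<epsilon> / 2"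
    using \<open>0 < \<epsilon>\<close> by (intro order_tendstoD) auto
  have "\<forall>\<^sub>F n in sequentially. norm (gap_frac c dec n g - P g) < \<epsilon>"
    using ev1 ev2 eventually_gt_at_top[of 0]
  proof eventually_elim
    case (elim n)
    then show ?case using frac_bound[of n] by simp
  qed
  then show "\<exists>n0. \<forall>n\<ge>n0. norm (gap_frac c dec n g - P g) < \<epsilon>"
    by (simp add: eventually_sequentially)
qed

text \<open>The bad event at \<open>n\<close> concerns only the coordinate
  \<open>\<omega> n\<close>, which is uniform on \<open>I n\<close>, so its probability is at most
  \<open>C * r ^ n\<close>. This is summable and Borel-Cantelli applies.\<close>

lemma AE_gap_ratio_close:
  assumes "0 < \<epsilon>"
  shows "AE \<omega> in PiM UNIV (\<lambda>n. uniform_count_measure (I n)).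
    \<forall>\<^sub>F n in sequentially. \<bar>count_list (gaps (dec (\<omega> n))) g / ngaps (\<omega> n) - P g\<bar> < \<epsilon>"
proof -
  let ?M = "\<lambda>n. uniform_count_measure (I n)"
  interpret M: prob_space "?M n" for n
    using card_I_pos[of n] by (intro prob_space_uniform_count_measure) (auto simp: card_gt_0_iff)
  interpret product_prob_space ?M UNIV ..
  obtain C r :: real where bad: "0 \<le> C" "0 < r" "r < 1"
    "\<And>n. card {m \<in> I n. \<epsilon> \<le> \<bar>count_list (gaps (dec m)) g / ngaps m - P g\<bar>} \<le> C * r ^ n * card (I n)"
    by (rule gap_ratio_tail[OF assms, of g]) (rule that)
  define B where "B n = {m \<in> I n. \<epsilon> \<le> \<bar>count_list (gaps (dec m)) g / ngaps m - P g\<bar>}" for n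
  define A where "A n = {\<omega> \<in> space (PiM UNIV ?M). \<omega> n \<in> B n}" for n
  have B_sets: "B n \<in> sets (?M n)" for n
    by (auto simp: B_def sets_uniform_count_measure)
  have A_eq: "A n = (\<lambda>\<omega>. \<omega> n) -` B n \<inter> space (PiM UNIV ?M)" for n
    by (auto simp: A_def)
  have A_sets: "A n \<in> sets (PiM UNIV ?M)" for n
    unfolding A_eq by (rule measurable_sets[of "\<lambda>\<omega>. \<omega> n" "PiM UNIV ?M" "?M n"]) (simp_all add: B_sets)
  have A_measure: "measure (PiM UNIV ?M) (A n) \<le> C * r ^ n" for n
  proof -
    have "measure (PiM UNIV ?M) (A n) = measure (distr (PiM UNIV ?M) (?M n) (\<lambda>\<omega>. \<omega> n)) (B n)"
      unfolding A_eq by (rule measure_distr[symmetric]) (auto simp: B_sets)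
    also have "distr (PiM UNIV ?M) (?M n) (\<lambda>\<omega>. \<omega> n) = ?M n"
      by (rule PiM_component) simp
    also have "measure (?M n) (B n) = card (B n) / card (I n)"
      by (rule measure_uniform_count_measure) (auto simp: B_def)
    also have "\<dots> \<le> C * r ^ n"
      using bad(4)[of n] card_I_pos[of n] by (simp add: B_def divide_le_eq)
    finally show ?thesis .
  qed
  have "summable (\<lambda>n. measure (PiM UNIV ?M) (A n))"
    by (rule summable_comparison_test'[of "\<lambda>n. C * r ^ n" 0])
       (use A_measure bad in \<open>auto intro!: summable_mult summable_geometric\<close>)
  then have "AE \<omega> in PiM UNIV ?M. \<forall>\<^sub>F n in sequentially. \<omega> \<in> space (PiM UNIV ?M) - A n"
    using A_sets by (intro borel_cantelli_AE1) (auto simp: less_top[symmetric])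
  then show ?thesis
  proof eventually_elim
    case (elim \<omega>)
    then show ?case
    proof eventually_elim
      case (elim n)
      then have "\<omega> n \<in> I n"
        by (auto simp: space_PiM PiE_def Pi_def space_uniform_count_measure)
      then show ?case using elim by (auto simp: A_def B_def)
    qed
  qed
qed

text \<open>Tolerances \<open>inverse (Suc j)\<close> leave countably many pairs of gap and
  tolerance, so one null set serves them all.\<close>

lemma AE_gap_ratio_tendsto:
  "AE \<omega> in PiM UNIV (\<lambda>n. uniform_count_measure (I n)).
    \<forall>g. (\<lambda>n. count_list (gaps (dec (\<omega> n))) g / ngaps (\<omega> n)) \<longlonglongrightarrow> P g"
proof -
  have "AE \<omega> in PiM UNIV (\<lambda>n. uniform_count_measure (I n)).
    \<forall>g j. \<forall>\<^sub>F n in sequentially.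
      \<bar>count_list (gaps (dec (\<omega> n))) g / ngaps (\<omega> n) - P g\<bar> < inverse (Suc j)"
    unfolding AE_all_countable by (intro allI AE_gap_ratio_close) simp
  then show ?thesis
  proof eventually_elim
    case (elim \<omega>)
    show ?case
    proof (intro allI tendstoI)
      fix g and \<epsilon> :: real assume "0 < \<epsilon>"
      then obtain j where j: "inverse (Suc j) < \<epsilon>" using reals_Archimedean by blast
      have "\<forall>\<^sub>F n in sequentially.
          \<bar>count_list (gaps (dec (\<omega> n))) g / ngaps (\<omega> n) - P g\<bar> < inverse (Suc j)"
        using elim by blast
      then show "\<forall>\<^sub>F n in sequentially. dist (count_list (gaps (dec (\<omega> n))) g / ngaps (\<omega> n)) (P g) < \<epsilon>"
        by eventually_elim (use j in \<open>simp add: dist_real_def\<close>)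
    qed
  qed
qed

end

section \<open>The (4,1)-Generacci and Fibonacci Quilt sequences\<close>

text \<open>The induction step shared by both sequences, with the notion of legality as a
  parameter.\<close>

lemma Least_not_representable:
  fixes L :: "nat list" and s :: "nat \<Rightarrow> nat"
  assumes L: "\<And>i. i \<in> {1..k} \<Longrightarrow> L ! (i - 1) = s i" and pos: "0 < s (Suc k)"
    and rep: "\<And>m. m < s (Suc k) \<Longrightarrow> \<exists>S\<subseteq>{1..k}. legal S \<and> sum s S = m"
    and not_rep: "\<And>S. \<lbrakk>S \<subseteq> {1..k}; legal S\<rbrakk> \<Longrightarrow> sum s S \<noteq> s (Suc k)"
  shows "(LEAST m. 0 < m \<and> \<not> (\<exists>S. S \<subseteq> {1..k} \<and> legal S \<and> (\<Sum>i\<in>S. L ! (i - 1)) = m)) = s (Suc k)"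
proof -
  have eq: "(\<Sum>i\<in>S. L ! (i - 1)) = sum s S" if "S \<subseteq> {1..k}" for S
    using that by (intro sum.cong L) auto
  show ?thesis
  proof (rule Least_equality)
    show "0 < s (Suc k) \<and> \<not> (\<exists>S. S \<subseteq> {1..k} \<and> legal S \<and> (\<Sum>i\<in>S. L ! (i - 1)) = s (Suc k))"
      using pos not_rep eq by metis
    fix m assume "0 < m \<and> \<not> (\<exists>S. S \<subseteq> {1..k} \<and> legal S \<and> (\<Sum>i\<in>S. L ! (i - 1)) = m)"
    then show "s (Suc k) \<le> m" using rep[of m] eq by (metis not_le)
  qed
qed

lemma nth_map_upt_1: "i \<in> {1..k} \<Longrightarrow> map s [1..<Suc k] ! (i - 1) = s i"
  by (auto simp: nth_map_upt simp del: upt_Suc)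

section \<open>The (4,1)-Generacci sequence\<close>

fun gen_seq :: "nat \<Rightarrow> nat" where
  "gen_seq n = (if n \<le> 5 then n else gen_seq (n - 1) + gen_seq (n - 5))"

declare gen_seq.simps [simp del]

lemma gen_seq_small: "n \<le> 5 \<Longrightarrow> gen_seq n = n"
  by (simp add: gen_seq.simps)

lemma gen_seq_Suc: "5 \<le> n \<Longrightarrow> gen_seq (Suc n) = gen_seq n + gen_seq (n - 4)"
  by (subst gen_seq.simps) simp

lemma gen_seq_pos: "0 < n \<Longrightarrow> 0 < gen_seq n"
proof (induction n rule: less_induct)
  case (less n)
  show ?case
    by (subst gen_seq.simps) (use less in auto)
qed

lemma gen_seq_less: "gen_seq n < gen_seq (Suc n)"
  by (cases "5 \<le> n") (simp_all add: gen_seq_Suc gen_seq_pos gen_seq_small)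

lemma gen_legal_subset: "gen_legal S \<Longrightarrow> T \<subseteq> S \<Longrightarrow> gen_legal T"
  unfolding gen_legal_def by (meson finite_subset subsetD)

lemma gen_legal_insert:
  assumes "gen_legal S" "S \<subseteq> {1..n - 5}"
  shows "gen_legal (insert n S)"
  using assms unfolding gen_legal_def idist_def by fastforce

lemma gen_legal_remove:
  assumes "gen_legal S" "S \<subseteq> {1..n}" "n \<in> S"
  shows "gen_legal (S - {n})" "S - {n} \<subseteq> {1..n - 5}"
proof -
  show "S - {n} \<subseteq> {1..n - 5}"
  proof
    fix x assume x: "x \<in> S - {n}"
    then have "5 \<le> idist x n" "1 \<le> x" "x \<le> n" using assms unfolding gen_legal_def by auto
    then show "x \<in> {1..n - 5}" by (simp add: idist_def)
  qed
qed (use gen_legal_subset[OF assms(1)] in blast)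

lemma subset_atLeast1_pred:
  assumes "S \<subseteq> {1..n::nat}" "n \<notin> S"
  shows "S \<subseteq> {1..n - 1}"
proof
  fix x assume "x \<in> S"
  then have "x \<noteq> n" "1 \<le> x" "x \<le> n" using assms by auto
  then show "x \<in> {1..n - 1}" by simp
qed

lemma Suc_diff_5: "5 \<le> n \<Longrightarrow> Suc (n - 5) = n - 4"
  by simp

text \<open>Without its largest index \<open>n\<close> the set lies in \<open>{1..n - 5}\<close>, so
  by induction the rest is below \<open>gen_seq (n - 4)\<close>, the increment of the
  recurrence.\<close>

lemma gen_sum_less: "\<lbrakk>gen_legal S; S \<subseteq> {1..n}\<rbrakk> \<Longrightarrow> sum gen_seq S < gen_seq (Suc n)"
proof (induction n arbitrary: S rule: less_induct)
  case (less n)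
  have fin: "finite S" using less.prems by (simp add: gen_legal_def)
  show ?case
  proof (cases "n \<in> S")
    case True
    note rem = gen_legal_remove[OF less.prems True]
    have n: "0 < n" using less.prems True by auto
    have S: "sum gen_seq S = gen_seq n + sum gen_seq (S - {n})"
      using fin True by (simp add: sum.remove)
    show ?thesis
    proof (cases "5 \<le> n")
      case True
      have "sum gen_seq (S - {n}) < gen_seq (Suc (n - 5))"
        using less.IH[of "n - 5" "S - {n}"] n rem by simp
      also have "Suc (n - 5) = n - 4" using True by simp
      finally show ?thesis using S True by (simp add: gen_seq_Suc)
    next
      case False
      then have "S - {n} = {}" using rem(2) by auto
      then show ?thesis using S gen_seq_less[of n] by (simp only: sum.empty)
    qed
  next
    case False
    then have S: "S \<subseteq> {1..n - 1}" using subset_atLeast1_pred less.prems by blast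
    show ?thesis
    proof (cases "n = 0")
      case True
      then show ?thesis using less.prems gen_seq_pos by simp
    next
      case False
      then have "sum gen_seq S < gen_seq n" using less.IH[of "n - 1" S] less.prems S by simp
      then show ?thesis using gen_seq_less[of n] by simp
    qed
  qed
qed

text \<open>Greedy choice: after subtracting \<open>gen_seq n\<close> the remainder is below
  \<open>gen_seq (n - 4)\<close>, so its indices stay at distance at least 5 from
  \<open>n\<close>.\<close>

lemma gen_rep_exists: "m < gen_seq (Suc n) \<Longrightarrow> \<exists>S\<subseteq>{1..n}. gen_legal S \<and> sum gen_seq S = m"
proof (induction n arbitrary: m rule: less_induct)
  case (less n)
  consider "n = 0" | "0 < n" "m < gen_seq n" | "0 < n" "n < 5" "gen_seq n \<le> m" | "5 \<le> n" "gen_seq n \<le> m"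
    by linarith
  then show ?case
  proof cases
    case 1
    then show ?thesis using less.prems by (intro exI[of _ "{}"]) (auto simp: gen_legal_def gen_seq_small)
  next
    case 2
    then obtain S where "S \<subseteq> {1..n - 1}" "gen_legal S" "sum gen_seq S = m"
      using less.IH[of "n - 1" m] by auto
    moreover have "{1..n - 1} \<subseteq> {1..n}" by auto
    ultimately show ?thesis by blast
  next
    case 3
    then have "m = n" using less.prems by (simp add: gen_seq_small)
    then show ?thesis using 3 by (intro exI[of _ "{n}"]) (auto simp: gen_legal_def gen_seq_small)
  next
    case 4
    then have "m - gen_seq n < gen_seq (Suc (n - 5))"
      using less.prems gen_seq_Suc[of n] Suc_diff_5[of n] by simp
    then obtain S where S: "S \<subseteq> {1..n - 5}" "gen_legal S" "sum gen_seq S = m - gen_seq n"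
      using less.IH[of "n - 5"] 4 by auto
    have "n \<notin> S" using S(1) 4(1) by auto
    moreover have "finite S" using S(2) by (simp add: gen_legal_def)
    ultimately have "sum gen_seq (insert n S) = m" using S(3) 4(2) by simp
    moreover have "S \<subseteq> {1..n}" using S(1) by (rule order.trans) auto
    then have "insert n S \<subseteq> {1..n}" using 4(1) by simp
    ultimately show ?thesis using gen_legal_insert[OF S(2,1)] by blast
  qed
qed

text \<open>A set avoiding \<open>n\<close> has sum below \<open>gen_seq n\<close>, so equal sums
  force both sets to contain \<open>n\<close> or both to avoid it.\<close>

lemma gen_rep_unique:
  "\<lbrakk>gen_legal S; gen_legal T; S \<subseteq> {1..n}; T \<subseteq> {1..n}; sum gen_seq S = sum gen_seq T\<rbrakk> \<Longrightarrow> S = T"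
proof (induction n arbitrary: S T rule: less_induct)
  case (less n)
  have fin: "finite S" "finite T" using less.prems by (auto simp: gen_legal_def)
  have mem: "n \<in> B" if "n \<in> A" "gen_legal B" "A \<subseteq> {1..n}" "B \<subseteq> {1..n}" "finite A"
    "sum gen_seq A = sum gen_seq B" for A B
  proof (rule ccontr)
    assume "n \<notin> B"
    have "0 < n" using that by auto
    have "sum gen_seq B < gen_seq n"
      using gen_sum_less[OF that(2) subset_atLeast1_pred[OF that(4) \<open>n \<notin> B\<close>]] \<open>0 < n\<close> by simp
    moreover have "gen_seq n \<le> sum gen_seq A" using that by (intro member_le_sum) auto
    ultimately show False using that by simp
  qed
  show ?case
  proof (cases "n \<in> S")
    case True
    then have T: "n \<in> T" using mem[of S T] less.prems fin by simp
    have "0 < n" using True less.prems by auto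
    have "sum gen_seq (S - {n}) = sum gen_seq (T - {n})"
      using fin True T less.prems(5) by (simp add: sum.remove)
    then have "S - {n} = T - {n}"
      using less.IH[of "n - 5" "S - {n}" "T - {n}"] gen_legal_remove[OF less.prems(1,3) True]
        gen_legal_remove[OF less.prems(2,4) T] \<open>0 < n\<close> by auto
    then show ?thesis using True T by blast
  next
    case False
    then have T: "n \<notin> T" using mem[of T S] less.prems fin by auto
    have sub: "S \<subseteq> {1..n - 1}" "T \<subseteq> {1..n - 1}"
      using subset_atLeast1_pred False T less.prems by blast+
    show ?thesis
    proof (cases "n = 0")
      case True
      then show ?thesis using less.prems by auto
    next
      case False
      then show ?thesis using less.IH[of "n - 1" S T] less.prems sub by simp
    qed
  qed
qed

lemma glist_eq: "glist k = map gen_seq [1..<Suc k]"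
proof (induction k)
  case (Suc k)
  have "(LEAST m. 0 < m \<and> \<not> (\<exists>S. S \<subseteq> {1..k} \<and> gen_legal S \<and> (\<Sum>i\<in>S. glist k ! (i - 1)) = m))
      = gen_seq (Suc k)"
  proof (rule Least_not_representable)
    show "glist k ! (i - 1) = gen_seq i" if "i \<in> {1..k}" for i
      unfolding Suc.IH using that by (rule nth_map_upt_1)
    show "sum gen_seq S \<noteq> gen_seq (Suc k)" if "S \<subseteq> {1..k}" "gen_legal S" for S
      using gen_sum_less[of S k] that by simp
  qed (use gen_seq_pos gen_rep_exists in auto)
  then show ?case using Suc.IH by simp
qed simp

lemma ga_eq: "ga = gen_seq"
proof
  fix i
  show "ga i = gen_seq i"
    using nth_map_upt_1[of i i gen_seq] by (cases "i = 0") (simp_all add: ga_def glist_eq gen_seq_small)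
qed

lemma gen_decomp_sum:
  assumes "S \<subseteq> {1..}" "gen_legal S"
  shows "gen_decomp (sum gen_seq S) = rev (sorted_list_of_set S)"
proof -
  have "(THE T. T \<subseteq> {1..} \<and> gen_legal T \<and> sum gen_seq T = sum gen_seq S) = S"
  proof (rule the_equality)
    fix T assume T: "T \<subseteq> {1..} \<and> gen_legal T \<and> sum gen_seq T = sum gen_seq S"
    have "finite (S \<union> T)" using T assms by (simp add: gen_legal_def)
    then obtain n where "\<forall>x\<in>S \<union> T. x \<le> n" using finite_nat_set_iff_bounded_le by blast
    then have "S \<subseteq> {1..n}" "T \<subseteq> {1..n}" using T assms by force+
    then show "T = S" using gen_rep_unique[of T S n] T assms by simp
  qed (use assms in simp)
  then show ?thesis by (simp add: gen_decomp_def ga_eq)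
qed

lemma sorted_list_of_set_insert_greatest:
  assumes "finite S" "\<And>x. x \<in> S \<Longrightarrow> x < n"
  shows "sorted_list_of_set (insert n S) = sorted_list_of_set S @ [n]"
proof -
  have "sorted (sorted_list_of_set S @ [n])" "distinct (sorted_list_of_set S @ [n])"
    using assms by (auto simp: sorted_append less_imp_le)
  from sorted_list_of_set.idem_if_sorted_distinct[OF this] show ?thesis
    using assms by simp
qed

text \<open>Adding \<open>n\<close> to a representation of the remainder is legal, and by uniqueness
  it is the decomposition.\<close>

lemma gen_decomp_rec:
  assumes "5 \<le> n" "m \<in> {ga n..<ga (Suc n)}"
  shows "gen_decomp m = n # gen_decomp (m - ga n)"
proof -
  have m: "gen_seq n \<le> m" "m < gen_seq (Suc n)" using assms by (auto simp: ga_eq)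
  then have "m - gen_seq n < gen_seq (Suc (n - 5))"
    using assms gen_seq_Suc[of n] Suc_diff_5[of n] by simp
  then obtain S where S: "S \<subseteq> {1..n - 5}" "gen_legal S" "sum gen_seq S = m - gen_seq n"
    using gen_rep_exists by blast
  have fin: "finite S" using S(2) by (simp add: gen_legal_def)
  have less: "x < n" if "x \<in> S" for x using that S(1) assms(1) by fastforce
  have "n \<notin> S" using less by blast
  then have "sum gen_seq (insert n S) = m" using S(3) m fin by simp
  moreover have "insert n S \<subseteq> {1..}" "S \<subseteq> {1..}" using S(1) assms(1) by auto
  ultimately have "gen_decomp m = rev (sorted_list_of_set (insert n S))"
    "gen_decomp (m - gen_seq n) = rev (sorted_list_of_set S)"
    using gen_decomp_sum[of "insert n S"] gen_decomp_sum[of S] gen_legal_insert[OF S(2,1)] S by simp_all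
  then show ?thesis
    using sorted_list_of_set_insert_greatest[OF fin less] by (simp add: ga_eq)
qed

section \<open>The Fibonacci Quilt sequence and its two recurrences\<close>

fun quilt_seq :: "nat \<Rightarrow> nat" where
  "quilt_seq n = (if n \<le> 5 then n else if n = 6 then 7 else quilt_seq (n - 1) + quilt_seq (n - 5))"

declare quilt_seq.simps [simp del]

lemma quilt_seq_small: "n \<le> 5 \<Longrightarrow> quilt_seq n = n" "quilt_seq 6 = 7"
  by (simp_all add: quilt_seq.simps)

text \<open>The range starts at 6 because at 5 the formula would give 5 + 1 = 6, which is the legal
  sum 4 + 2; the next term is 7.\<close>

lemma quilt_seq_Suc: "6 \<le> n \<Longrightarrow> quilt_seq (Suc n) = quilt_seq n + quilt_seq (n - 4)"
  by (subst quilt_seq.simps) simp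

lemma quilt_seq_7_8_9: "quilt_seq 7 = 9" "quilt_seq 8 = 12" "quilt_seq 9 = 16"
  using quilt_seq_Suc[of 6] quilt_seq_Suc[of 7] quilt_seq_Suc[of 8] by (simp_all add: quilt_seq_small)

lemma quilt_seq_pos: "0 < n \<Longrightarrow> 0 < quilt_seq n"
proof (induction n rule: less_induct)
  case (less n)
  show ?case
    by (subst quilt_seq.simps) (use less in auto)
qed

lemma quilt_seq_less: "quilt_seq n < quilt_seq (Suc n)"
proof (cases "6 \<le> n")
  case False
  then consider "n < 5" | "n = 5" by linarith
  then show ?thesis by cases (simp_all add: quilt_seq_small)
qed (simp add: quilt_seq_Suc quilt_seq_pos)

lemma quilt_seq_mono: "m \<le> n \<Longrightarrow> quilt_seq m \<le> quilt_seq n"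
  by (rule lift_Suc_mono_le) (use quilt_seq_less less_imp_le in auto)

lemma quilt_seq_strict_mono: "m < n \<Longrightarrow> quilt_seq m < quilt_seq n"
  by (rule lift_Suc_mono_less) (use quilt_seq_less in auto)

text \<open>Substituting this identity for \<open>n - 1\<close> and \<open>n - 2\<close> into the
  other recurrence reproduces it for \<open>n\<close>; hence the two base cases 4 and 5.\<close>

lemma quilt_seq_skip: "4 \<le> n \<Longrightarrow> quilt_seq (Suc n) = quilt_seq (n - 1) + quilt_seq (n - 2)"
proof (induction n rule: less_induct)
  case (less n)
  consider "n = 4" | "n = 5" | "6 \<le> n" using less.prems by linarith
  then show ?case
  proof cases
    case 3
    have "quilt_seq n = quilt_seq (n - 2) + quilt_seq (n - 3)"
      "quilt_seq (n - 1) = quilt_seq (n - 3) + quilt_seq (n - 4)"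
    proof -
      have "Suc (n - 1) = n" "n - 1 - 1 = n - 2" "n - 1 - 2 = n - 3"
        "Suc (n - 2) = n - 1" "n - 2 - 1 = n - 3" "n - 2 - 2 = n - 4" "n - 1 < n" "n - 2 < n" "4 \<le> n - 1" "4 \<le> n - 2"
        using 3 by simp_all
      then show "quilt_seq n = quilt_seq (n - 2) + quilt_seq (n - 3)"
        "quilt_seq (n - 1) = quilt_seq (n - 3) + quilt_seq (n - 4)"
        using less.IH[of "n - 1"] less.IH[of "n - 2"] by metis+
    qed
    then show ?thesis using quilt_seq_Suc[OF 3] by simp
  qed (simp_all add: quilt_seq_small)
qed

section \<open>Sums over FQ-legal index sets\<close>

lemma FQ_legal_subset: "FQ_legal S \<Longrightarrow> T \<subseteq> S \<Longrightarrow> FQ_legal T"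
  unfolding FQ_legal_def by (meson finite_subset subset_trans subsetD)

lemma FQ_legal_insert:
  assumes "FQ_legal S" "S \<subseteq> {1..n - 5}" "6 \<le> n"
  shows "FQ_legal (insert n S)"
proof -
  have d: "idist n x \<notin> {0, 1, 3, 4} \<and> idist x n \<notin> {0, 1, 3, 4}" if "x \<in> S" for x
  proof -
    have "x \<le> n - 5" using that assms(2) by auto
    then show ?thesis using assms(3) by (auto simp: idist_def)
  qed
  show ?thesis
    unfolding FQ_legal_def
  proof (intro conjI ballI impI)
    fix i j assume "i \<in> insert n S" "j \<in> insert n S" "i \<noteq> j"
    then show "idist i j \<notin> {0, 1, 3, 4}"
      using d assms(1) unfolding FQ_legal_def by auto
  qed (use assms in \<open>auto simp: FQ_legal_def\<close>)
qed

text \<open>Distance 2 is the only positive distance below 5 that legality allows.\<close>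

lemma FQ_legal_below_max:
  assumes "FQ_legal S" "S \<subseteq> {1..n}" "n \<in> S" "x \<in> S - {n}"
  shows "x \<in> {1..n - 5} \<or> x = n - 2"
proof -
  have "idist x n \<notin> {0, 1, 3, 4}" "1 \<le> x" "x \<le> n"
    using assms unfolding FQ_legal_def by auto
  then show ?thesis by (simp add: idist_def) linarith
qed

lemma FQ_legal_below_two:
  assumes "FQ_legal S" "S \<subseteq> {1..n}" "n \<in> S" "n - 2 \<in> S - {n}" "x \<in> S - {n} - {n - 2}"
  shows "x \<in> {1..n - 7}"
proof -
  have "idist x (n - 2) \<notin> {0, 1, 3, 4}" "1 \<le> x" "n - 2 \<noteq> n"
    using assms unfolding FQ_legal_def by auto
  moreover have "x \<le> n - 5" using FQ_legal_below_max[OF assms(1-3), of x] assms(5) by auto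
  ultimately show ?thesis by (simp add: idist_def split: if_splits) linarith
qed

text \<open>Split off \<open>n\<close>, and \<open>n - 2\<close> if present. The rest lies below
  \<open>n - 5\<close> or \<open>n - 7\<close>, and the induction bound plus a possible
  \<open>quilt_seq (n - 2)\<close> is at most \<open>quilt_seq (Suc n)\<close> by
  \<open>quilt_seq_skip\<close>.\<close>

lemma FQ_sum_less:
  "\<lbrakk>FQ_legal S; S \<subseteq> {1..n}\<rbrakk> \<Longrightarrow> sum quilt_seq S < quilt_seq n + quilt_seq (Suc n)"
proof (induction n arbitrary: S rule: less_induct)
  case (less n)
  have fin: "finite S" using less.prems by (simp add: FQ_legal_def)
  have IH: "sum quilt_seq T < quilt_seq k + quilt_seq (Suc k)" if "k < n" "T \<subseteq> S" "T \<subseteq> {1..k}" for T k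
    using less.IH that FQ_legal_subset less.prems by blast
  show ?case
  proof (cases "n \<in> S")
    case True
    have n: "0 < n" using less.prems True by auto
    have S: "sum quilt_seq S = quilt_seq n + sum quilt_seq (S - {n})"
      using fin True by (simp add: sum.remove)
    show ?thesis
    proof (cases "n - 2 \<in> S - {n}")
      case two: True
      then have n3: "3 \<le> n" using less.prems by auto
      have S2: "sum quilt_seq (S - {n}) = quilt_seq (n - 2) + sum quilt_seq (S - {n} - {n - 2})"
        using fin two by (intro sum.remove) auto
      have sub: "S - {n} - {n - 2} \<subseteq> {1..n - 7}"
        using FQ_legal_below_two[OF less.prems True two] by blast
      have "sum quilt_seq (S - {n} - {n - 2}) < quilt_seq (n - 7) + quilt_seq (Suc (n - 7))"
        using n sub by (intro IH) auto
      moreover have "quilt_seq (n - 2) + (quilt_seq (n - 7) + quilt_seq (Suc (n - 7))) \<le> quilt_seq (Suc n)"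
      proof -
        \<comment> \<open>Applying \<open>quilt_seq_skip\<close> at \<open>n - 5\<close> requires
          \<open>n \<ge> 9\<close>; smaller values are computed.\<close>
        consider "n = 3" | "n = 4" | "n = 5" | "n = 6" | "n = 7" | "n = 8" | "9 \<le> n" using n3 by linarith
        then show ?thesis
        proof cases
          case 7
          have "quilt_seq (n - 4) = quilt_seq (n - 6) + quilt_seq (n - 7)"
          proof -
            have "Suc (n - 5) = n - 4" "n - 5 - 1 = n - 6" "n - 5 - 2 = n - 7" "4 \<le> n - 5"
              using 7 by simp_all
            then show ?thesis using quilt_seq_skip[of "n - 5"] by metis
          qed
          moreover have "Suc (n - 7) = n - 6" using 7 by simp
          moreover have "quilt_seq (n - 4) \<le> quilt_seq (n - 1)" by (intro quilt_seq_mono) simp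
          ultimately show ?thesis using quilt_seq_skip[of n] 7 by simp
        qed (simp_all add: quilt_seq_7_8_9 quilt_seq_small)
      qed
      ultimately show ?thesis using S S2 by linarith
    next
      case False
      then have sub: "S - {n} \<subseteq> {1..n - 5}"
        using FQ_legal_below_max[OF less.prems True] by blast
      have "sum quilt_seq (S - {n}) < quilt_seq (n - 5) + quilt_seq (Suc (n - 5))"
        using n sub by (intro IH) auto
      moreover have "quilt_seq (n - 5) + quilt_seq (Suc (n - 5)) \<le> quilt_seq (Suc n)"
      proof (cases "5 \<le> n")
        case True
        have "quilt_seq (n - 5) \<le> quilt_seq (n - 2)" "quilt_seq (Suc (n - 5)) \<le> quilt_seq (n - 1)"
          using True by (auto intro!: quilt_seq_mono)
        then show ?thesis using quilt_seq_skip[of n] True by simp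
      next
        case False
        then show ?thesis using quilt_seq_mono[of 1 "Suc n"] by (simp add: quilt_seq_small)
      qed
      ultimately show ?thesis using S by linarith
    qed
  next
    case False
    then have S: "S \<subseteq> {1..n - 1}" using subset_atLeast1_pred less.prems by blast
    show ?thesis
    proof (cases "n = 0")
      case True
      then show ?thesis using less.prems quilt_seq_pos by simp
    next
      case False
      then have "sum quilt_seq S < quilt_seq (n - 1) + quilt_seq n" using IH[of "n - 1" S] S by simp
      then show ?thesis using quilt_seq_mono[of "n - 1" n] quilt_seq_less[of n] by simp
    qed
  qed
qed

text \<open>A finite check with one Boolean per index: the only legal sets with two or more elements
  are {2, 4} and {3, 5}, with sums 6 and 8.\<close>

lemma FQ_not_rep_small:
  assumes "FQ_legal S" "S \<subseteq> {1..k}" "k \<le> 5"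
  shows "sum quilt_seq S \<noteq> quilt_seq (Suc k)"
proof -
  define b where "b i = (i \<in> S)" for i :: nat
  have "sum quilt_seq S = (\<Sum>i\<in>{1..k}. if b i then quilt_seq i else 0)"
    using assms(2) by (simp add: b_def Int_absorb1 flip: sum.inter_restrict)
  also have "\<dots> = (\<Sum>i\<in>{1..5}. if b i then quilt_seq i else 0)"
    using assms by (intro sum.mono_neutral_left) (auto simp: b_def)
  also have "\<dots> = of_bool (b 1) * 1 + of_bool (b 2) * 2 + of_bool (b 3) * 3 + of_bool (b 4) * 4 + of_bool (b 5) * 5"
    by (simp add: numeral_eq_Suc quilt_seq_small)
  finally have sum: "sum quilt_seq S = \<dots>" .
  have excl: "\<not> (b i \<and> b j)" if "i \<noteq> j" "idist i j \<in> {0, 1, 3, 4}" for i j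
    using assms(1) that unfolding FQ_legal_def b_def by blast
  have ex: "\<not> (b 1 \<and> b 2)" "\<not> (b 2 \<and> b 3)" "\<not> (b 3 \<and> b 4)" "\<not> (b 4 \<and> b 5)"
    "\<not> (b 1 \<and> b 4)" "\<not> (b 2 \<and> b 5)" "\<not> (b 1 \<and> b 5)"
    by (rule excl; simp add: idist_def)+
  \<comment> \<open>This separate exclusion prevents 1 + 3 from representing 4.\<close>
  have ex13: "\<not> (b 1 \<and> b 3)"
    using assms(1) by (simp add: FQ_legal_def b_def)
  have le: "i \<le> k" if "b i" for i
    using assms(2) that by (auto simp: b_def)
  have not_b: "k < 5 \<Longrightarrow> \<not> b 5" "k < 4 \<Longrightarrow> \<not> b 4" "k < 3 \<Longrightarrow> \<not> b 3" "k < 2 \<Longrightarrow> \<not> b 2" "k < 1 \<Longrightarrow> \<not> b 1"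
    using le by (meson not_le)+
  consider "k = 0" | "k = 1" | "k = 2" | "k = 3" | "k = 4" | "k = 5"
    using assms(3) by linarith
  then show ?thesis
  proof cases
    case 1
    then show ?thesis using assms by (simp add: quilt_seq_small)
  next
    case 2
    then show ?thesis using sum not_b by (simp add: quilt_seq_small)
  next
    case 3
    then show ?thesis using sum not_b ex by (cases "b 1"; cases "b 2") (simp_all add: quilt_seq_small)
  next
    case 4
    then show ?thesis using sum not_b ex ex13
      by (cases "b 1"; cases "b 2"; cases "b 3") (simp_all add: quilt_seq_small)
  next
    case 5
    then show ?thesis using sum not_b ex ex13
      by (cases "b 1"; cases "b 2"; cases "b 3"; cases "b 4") (simp_all add: quilt_seq_small)
  next
    case 6
    then show ?thesis using sum ex ex13
      by (cases "b 1"; cases "b 2"; cases "b 3"; cases "b 4"; cases "b 5") (simp_all add: quilt_seq_small)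
  qed
qed

text \<open>If \<open>n\<close> is used, the rest would have to be \<open>quilt_seq (n - 4)\<close>:
  too small if \<open>n - 2\<close> is used, excluded by induction otherwise. If the largest index
  is \<open>n - 1\<close>, the rest would have to be \<open>quilt_seq (n - 2)\<close>, again
  excluded by induction. If neither is used, \<open>FQ_sum_less\<close> keeps the sum below
  \<open>quilt_seq (Suc n)\<close>.\<close>

lemma FQ_not_rep: "\<lbrakk>FQ_legal S; S \<subseteq> {1..n}\<rbrakk> \<Longrightarrow> sum quilt_seq S \<noteq> quilt_seq (Suc n)"
proof (induction n arbitrary: S rule: less_induct)
  case (less n)
  have fin: "finite S" using less.prems by (simp add: FQ_legal_def)
  show ?case
  proof (cases "n \<le> 5")
    case True
    then show ?thesis using FQ_not_rep_small less.prems by blast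
  next
    case False
    then have n: "6 \<le> n" by simp
    have IH: "sum quilt_seq T \<noteq> quilt_seq (Suc k)" if "k < n" "T \<subseteq> S" "T \<subseteq> {1..k}" for T k
      using less.IH that FQ_legal_subset less.prems by blast
    consider "n \<in> S" | "n \<notin> S" "n - 1 \<in> S" | "n \<notin> S" "n - 1 \<notin> S" by blast
    then show ?thesis
    proof cases
      case 1
      have S: "sum quilt_seq S = quilt_seq n + sum quilt_seq (S - {n})"
        using fin 1 by (simp add: sum.remove)
      have "sum quilt_seq (S - {n}) \<noteq> quilt_seq (n - 4)"
      proof (cases "n - 2 \<in> S - {n}")
        case True
        have "quilt_seq (n - 4) < quilt_seq (n - 2)" using n by (intro quilt_seq_strict_mono) simp
        moreover have "quilt_seq (n - 2) \<le> sum quilt_seq (S - {n})"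
          using fin True by (intro member_le_sum) auto
        ultimately show ?thesis by simp
      next
        case False
        then have "S - {n} \<subseteq> {1..n - 5}" using FQ_legal_below_max[OF less.prems 1] by blast
        then have "sum quilt_seq (S - {n}) \<noteq> quilt_seq (Suc (n - 5))" using n by (intro IH) auto
        moreover have "Suc (n - 5) = n - 4" using n by simp
        ultimately show ?thesis by simp
      qed
      then show ?thesis using S quilt_seq_Suc[OF n] by simp
    next
      case 2
      have sub: "S \<subseteq> {1..n - 1}" using subset_atLeast1_pred[OF less.prems(2) 2(1)] .
      have S: "sum quilt_seq S = quilt_seq (n - 1) + sum quilt_seq (S - {n - 1})"
        using fin 2 by (simp add: sum.remove)
      have "S - {n - 1} \<subseteq> {1..n - 3}"
        using FQ_legal_below_max[OF less.prems(1) sub 2(2)] n by fastforce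
      then have "sum quilt_seq (S - {n - 1}) \<noteq> quilt_seq (Suc (n - 3))" using n by (intro IH) auto
      moreover have "Suc (n - 3) = n - 2" using n by simp
      ultimately show ?thesis using S quilt_seq_skip[of n] n by simp
    next
      case 3
      have "S \<subseteq> {1..n - 1 - 1}"
        using subset_atLeast1_pred[OF subset_atLeast1_pred[OF less.prems(2) 3(1)] 3(2)] .
      then have "sum quilt_seq S < quilt_seq (n - 2) + quilt_seq (Suc (n - 2))"
        using FQ_sum_less[OF less.prems(1), of "n - 2"] by (simp add: numeral_2_eq_2)
      moreover have "Suc (n - 2) = n - 1" using n by simp
      ultimately show ?thesis using quilt_seq_skip[of n] n by simp
    qed
  qed
qed

text \<open>Greedy as for the Generacci sequence once \<open>n \<ge> 6\<close>; below that a single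
  index suffices except for 6 = 4 + 2.\<close>

lemma FQ_rep_exists: "m < quilt_seq (Suc n) \<Longrightarrow> \<exists>S\<subseteq>{1..n}. FQ_legal S \<and> sum quilt_seq S = m"
proof (induction n arbitrary: m rule: less_induct)
  case (less n)
  consider "m = 0" | "m = 6" "n = 5" | "0 < m" "m \<le> n" "n \<le> 5" | "6 \<le> n" "m < quilt_seq n" | "6 \<le> n" "quilt_seq n \<le> m"
    using less.prems
    by (cases "n < 5"; cases "n = 5"; force simp: quilt_seq_small)
  then show ?case
  proof cases
    case 1
    then show ?thesis by (intro exI[of _ "{}"]) (auto simp: FQ_legal_def)
  next
    case 2
    then show ?thesis by (intro exI[of _ "{4, 2}"]) (auto simp: FQ_legal_def idist_def quilt_seq_small)
  next
    case 3
    then show ?thesis by (intro exI[of _ "{m}"]) (auto simp: FQ_legal_def quilt_seq_small)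
  next
    case 4
    then obtain S where "S \<subseteq> {1..n - 1}" "FQ_legal S" "sum quilt_seq S = m"
      using less.IH[of "n - 1" m] by auto
    moreover have "{1..n - 1} \<subseteq> {1..n}" by auto
    ultimately show ?thesis by blast
  next
    case 5
    then have "m - quilt_seq n < quilt_seq (Suc (n - 5))"
      using less.prems quilt_seq_Suc[of n] Suc_diff_5[of n] by simp
    then obtain S where S: "S \<subseteq> {1..n - 5}" "FQ_legal S" "sum quilt_seq S = m - quilt_seq n"
      using less.IH[of "n - 5"] 5 by auto
    have "n \<notin> S" using S(1) 5(1) by auto
    moreover have "finite S" using S(2) by (simp add: FQ_legal_def)
    ultimately have "sum quilt_seq (insert n S) = m" using S(3) 5(2) by simp
    moreover have "S \<subseteq> {1..n}" using S(1) by (rule order.trans) auto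
    then have "insert n S \<subseteq> {1..n}" using 5(1) by simp
    ultimately show ?thesis using FQ_legal_insert[OF S(2,1) 5(1)] by blast
  qed
qed

lemma qlist_eq: "qlist k = map quilt_seq [1..<Suc k]"
proof (induction k)
  case (Suc k)
  have "(LEAST m. 0 < m \<and> \<not> (\<exists>S. S \<subseteq> {1..k} \<and> FQ_legal S \<and> (\<Sum>i\<in>S. qlist k ! (i - 1)) = m))
      = quilt_seq (Suc k)"
  proof (rule Least_not_representable)
    show "qlist k ! (i - 1) = quilt_seq i" if "i \<in> {1..k}" for i
      unfolding Suc.IH using that by (rule nth_map_upt_1)
  qed (use quilt_seq_pos FQ_rep_exists FQ_not_rep in auto)
  then show ?case using Suc.IH by simp
qed simp

lemma fq_eq: "fq = quilt_seq"
proof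
  fix i
  show "fq i = quilt_seq i"
    using nth_map_upt_1[of i i quilt_seq] by (cases "i = 0") (simp_all add: fq_def qlist_eq quilt_seq_small)
qed

section \<open>The Greedy-6 decomposition\<close>

lemma quilt_seq_inj: "quilt_seq a = quilt_seq b \<Longrightarrow> a = b"
  by (metis linorder_neqE_nat nat_neq_iff quilt_seq_strict_mono)

lemma The_fq: "1 \<le> n \<Longrightarrow> (THE k. k \<ge> 1 \<and> fq k = fq n) = n"
  by (rule the_equality) (auto simp: fq_eq intro: quilt_seq_inj)

lemma between_fq_unique:
  assumes "fq l < m" "m < fq (Suc l)" "fq n < m" "m < fq (Suc n)"
  shows "l = n"
  using assms quilt_seq_mono[of "Suc l" n] quilt_seq_mono[of "Suc n" l]
  unfolding fq_eq by (cases l n rule: linorder_cases) auto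

lemma exists_between_fq:
  assumes "0 < m" "\<not> (\<exists>n\<ge>1. fq n = m)"
  shows "\<exists>n\<ge>1. fq n < m \<and> m < fq (Suc n)"
proof -
  have "n \<le> quilt_seq n" for n
  proof (induction n)
    case (Suc n)
    then show ?case using quilt_seq_less[of n] by simp
  qed simp
  then have ex: "m < quilt_seq (Suc m)" using Suc_le_lessD by blast
  define l where "l = (LEAST l. m < quilt_seq (Suc l))"
  have l: "m < quilt_seq (Suc l)" unfolding l_def using ex by (rule LeastI)
  have "l \<noteq> 0" using l assms by (intro notI) (simp add: quilt_seq_small)
  then have "\<not> m < quilt_seq l"
    using not_less_Least[of "l - 1" "\<lambda>l. m < quilt_seq (Suc l)"] unfolding l_def[symmetric] by simp
  then show ?thesis
    using assms(2) l \<open>l \<noteq> 0\<close> unfolding fq_eq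
    by (intro exI[of _ l]) (metis One_nat_def Suc_leI le_neq_implies_less neq0_conv not_less)
qed

lemma The_between_fq:
  assumes "1 \<le> n" "fq n < m" "m < fq (Suc n)"
  shows "(THE l. l \<ge> 1 \<and> fq l < m \<and> m < fq (Suc l)) = n"
  using assms between_fq_unique by (intro the_equality) blast+

lemma greedy_aux_0: "greedy_aux k 0 = []"
  by (cases k) auto

lemma greedy_aux_step:
  assumes "m \<noteq> 0" "\<not> (\<exists>n\<ge>1. fq n = m)" "m \<noteq> 6" "1 \<le> n" "fq n < m" "m < fq (Suc n)"
  shows "greedy_aux (Suc k) m = n # greedy_aux k (m - fq n)"
  by (subst greedy_aux.simps, unfold The_between_fq[OF assms(4-6)])
     (use assms(1-3) in \<open>simp only: if_False Let_def\<close>)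

text \<open>Each step lowers the number by at least 1, so the fuel never falls below what
  remains.\<close>

lemma greedy_aux_fuel: "\<lbrakk>m \<le> k; m \<le> j\<rbrakk> \<Longrightarrow> greedy_aux k m = greedy_aux j m"
proof (induction k arbitrary: j m)
  case 0
  then show ?case by (simp add: greedy_aux_0)
next
  case (Suc k)
  show ?case
  proof (cases "m = 0")
    case True
    then show ?thesis by (simp add: greedy_aux_0)
  next
    case False
    then obtain i where j: "j = Suc i" using Suc.prems by (cases j) auto
    show ?thesis
    proof (cases "(\<exists>n\<ge>1. fq n = m) \<or> m = 6")
      case True
      then show ?thesis using False j by auto
    next
      case no: False
      then obtain n where n: "1 \<le> n" "fq n < m" "m < fq (Suc n)"
        using exists_between_fq[of m] False by auto
      have "0 < fq n" using n(1) quilt_seq_pos by (simp add: fq_eq)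
      then have "greedy_aux k (m - fq n) = greedy_aux i (m - fq n)"
        using Suc.prems j False by (intro Suc.IH) auto
      moreover have "\<not> (\<exists>n\<ge>1. fq n = m)" "m \<noteq> 6" using no by blast+
      ultimately show ?thesis using greedy_aux_step[OF False _ _ n] j by simp
    qed
  qed
qed

text \<open>The terminating case \<open>m = fq n\<close> fits the same recursion, since the
  remainder 0 has the empty decomposition.\<close>

lemma greedy6_rec:
  assumes "6 \<le> n" "m \<in> {fq n..<fq (Suc n)}"
  shows "greedy6 m = n # greedy6 (m - fq n)"
proof -
  \<comment> \<open>This keeps \<open>m\<close> clear of the exceptional branch for 6.\<close>
  have "7 \<le> fq n" using quilt_seq_mono[OF assms(1)] by (simp add: fq_eq quilt_seq_small)
  then obtain k where m: "m = Suc k" "6 < m" using assms(2) by (cases m) auto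
  show ?thesis
  proof (cases "m = fq n")
    case True
    then have "\<exists>i\<ge>1. fq i = m" using assms(1) by (intro exI[of _ n]) auto
    moreover have "(THE i. i \<ge> 1 \<and> fq i = m) = n" using The_fq[of n] True assms(1) by simp
    ultimately show ?thesis using m True unfolding greedy6_def by (simp add: greedy_aux_0)
  next
    case False
    then have less: "fq n < m" "m < fq (Suc n)" using assms(2) by auto
    have no: "\<not> (\<exists>i\<ge>1. fq i = m)"
    proof
      assume "\<exists>i\<ge>1. fq i = m"
      then obtain i where "fq i = m" by blast
      then show False
        using less quilt_seq_mono[of i n] quilt_seq_mono[of "Suc n" i] unfolding fq_eq
        by (cases "i \<le> n") auto
    qed
    have "greedy6 m = n # greedy_aux k (m - fq n)"
      using greedy_aux_step[OF _ no _ _ less, of k] m assms(1) unfolding greedy6_def by simp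
    also have "greedy_aux k (m - fq n) = greedy6 (m - fq n)"
      unfolding greedy6_def using m \<open>7 \<le> fq n\<close> by (intro greedy_aux_fuel) auto
    finally show ?thesis .
  qed
qed

section \<open>The limit law\<close>

text \<open>The real and the truncated length minus 1 differ only for the empty list, where all
  counts vanish.\<close>

lemma indiv_gap_measure_eq:
  "indiv_gap_measure z = nat_point_measure
     (\<lambda>g. count_list (gaps (greedy6 z)) g / length (gaps (greedy6 z)))"
proof (cases "greedy6 z")
  case Nil
  then show ?thesis by (simp add: indiv_gap_measure_def gaps_def)
next
  case (Cons a as)
  then show ?thesis by (simp add: indiv_gap_measure_def length_gaps)
qed

theorem theorem1p17:
  "\<exists>P :: nat \<Rightarrow> real.
     (\<forall>g. (\<lambda>n. gap_frac fq greedy6 n g) \<longlonglongrightarrow> P g) \<and>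
     (\<forall>g. (\<lambda>n. gap_frac ga gen_decomp n g) \<longlonglongrightarrow> P g) \<and>
     (AE \<omega> in PiM UNIV (\<lambda>n. uniform_count_measure (FQ_interval n)).
        weak_conv_m (\<lambda>n. indiv_gap_measure (\<omega> n)) (nat_point_measure P))"
proof -
  \<comment> \<open>One root \<open>p\<close> is used for both sequences, so their limits
    coincide.\<close>
  obtain p :: real where p: "0 < p" "p < 1" "p ^ 5 = 1 - p"
    using exists_root_scaled[of 0 1] by auto
  \<comment> \<open>The recurrence of the Quilt sequence holds from index 6 on, that of the
    Generacci sequence from 5 on.\<close>
  interpret Q: gap_scheme p fq greedy6 6
    by standard (use p greedy6_rec in \<open>auto simp: fq_eq quilt_seq_small quilt_seq_Suc quilt_seq_less\<close>)
  interpret G: gap_scheme p ga gen_decomp 5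
    by standard (use p gen_decomp_rec in \<open>auto simp: ga_eq gen_seq_small gen_seq_Suc gen_seq_less\<close>)
  have "AE \<omega> in PiM UNIV (\<lambda>n. uniform_count_measure (FQ_interval n)).
      weak_conv_m (\<lambda>n. indiv_gap_measure (\<omega> n)) (nat_point_measure (limit_gap_prob p))"
    using Q.AE_gap_ratio_tendsto unfolding FQ_interval_def
  proof eventually_elim
    case (elim \<omega>)
    then show ?case
      unfolding indiv_gap_measure_eq by (intro weak_conv_m_nat_point_measure) auto
  qed
  then show ?thesis
    using Q.gap_frac_tendsto G.gap_frac_tendsto by blast
qed

end
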